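(* Let $k$ be a fixed positive integer. Then $$\frac{Z_{n,k}-\mathbb{E}[Z_{n,k}]}{\sqrt{\mathrm{Var}(Z_{n,k})}}\longrightarrow\mathcal{G}\quad\text{in distribution as }n\to\infty,$$ where $$\mathbb{E}[Z_{n,k}]=\binom nk\frac1{k!}$$ and $\mathrm{Var}(Z_{n,k})=\mathbb{E}[Z_{n,k}^2]-(\mathbb{E}[Z_{n,k}])^2$ with $$\mathbb{E}[Z_{n,k}^2]=\sum_{\substack{t,s\ge0\\ t+s\le k}}\frac{4^{k-t}}{(2k-t)!}\binom{n}{2k-t}\binom{k-t-s-1/2}{k-t-s}\binom{s+(t+1)/2-1}{s}\binom{2k-t}{2k-2t-2s}.$$
   Context: $Z_{n,k}=\sum_{1\le i_1<\cdots<i_k\le n}\mathbf{1}(\pi(i_1)<\cdots<\pi(i_k))$ is the number of increasing subsequences of length $k$ of a uniformly random permutation $\pi$ of $\{1,\ldots,n\}$. $\mathcal{G}$ is a standard normal random variable. For real $x$ and integer $m\ge0$, $\binom{x}{m}=x(x-1)\cdots(x-m+1)/m!$.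
   Formalization: The convergence in distribution is asserted only for k ≥ 2: for k = 1, Z_{n,1} = n is constant with variance 0, so the standardized variable is 0/0 for every n; the moment formulas are still proved for all k ≥ 1. *)

theory Defs
  imports "HOL-Probability.Probability" "HOL-Combinatorics.Permutations"
begin

definition uniform_permutation :: "nat \<Rightarrow> (nat \<Rightarrow> nat) pmf" where
  "uniform_permutation n = pmf_of_set {\<pi>. \<pi> permutes {1..n}}"

text \<open>An index tuple \<open>1 \<le> i\<^sub>1 < \<dots> < i\<^sub>k \<le> n\<close> is encoded as a strictly increasing list
  of length \<open>k\<close> with entries in \<open>{1..n}\<close>.\<close>

definition index_tuples :: "nat \<Rightarrow> nat \<Rightarrow> nat list set" where
  "index_tuples n k = {is. length is = k \<and> set is \<subseteq> {1..n} \<and> sorted_wrt (<) is}"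

definition Z :: "nat \<Rightarrow> nat \<Rightarrow> (nat \<Rightarrow> nat) \<Rightarrow> real" where
  "Z n k \<pi> = (\<Sum>is\<in>index_tuples n k. of_bool (sorted_wrt (<) (map \<pi> is)))"

text \<open>For \<open>k = 1\<close> the variable \<open>Z n k\<close> is the constant \<open>n\<close> and its variance is zero, so its
  standardization is 0/0 and a normal limit law only makes sense for \<open>k \<ge> 2\<close>; the moment
  formulas hold for all \<open>k \<ge> 1\<close>.\<close>

abbreviation mean_Z :: "nat \<Rightarrow> nat \<Rightarrow> real" where
  "mean_Z n k \<equiv> measure_pmf.expectation (uniform_permutation n) (Z n k)"

abbreviation var_Z :: "nat \<Rightarrow> nat \<Rightarrow> real" where
  "var_Z n k \<equiv> measure_pmf.variance (uniform_permutation n) (Z n k)"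

text \<open>The sum of the second-moment formula over all \<open>(t, s)\<close> with \<open>t + s \<le> k\<close>. Under this
  constraint no subtraction on the naturals below truncates. The two binomial coefficients with
  a fractional upper argument are generalized binomial coefficients over the reals.\<close>

definition second_moment_formula :: "nat \<Rightarrow> nat \<Rightarrow> real" where
  "second_moment_formula n k =
     (\<Sum>(t, s)\<in>{(t, s). t + s \<le> k}.
        4 ^ (k - t) / fact (2 * k - t) * real (n choose (2 * k - t))
        * ((real k - real t - real s - 1 / 2) gchoose (k - t - s))
        * ((real s + (real t + 1) / 2 - 1) gchoose s)
        * real ((2 * k - t) choose (2 * k - 2 * t - 2 * s)))"

end

theory Submission
  imports Defs "HOL-Computational_Algebra.Computational_Algebra" "HOL-Real_Asymp.Real_Asymp"
begin

text \<open>
  Moments. To say that \<open>\<pi>\<close> is increasing along an index tuple is to say that it maps the tuple to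
  some other index tuple. Hence the expectation of \<open>(Z n k \<pi>)\<^sup>2\<close> is a sum over two pairs of tuples, the
  second pair being the image of the first, of the probability that \<open>\<pi>\<close> takes the prescribed values.
  If the prescription is consistent and the first pair has a union of \<open>m\<close> elements, then
  \<open>(n - m)!\<close> permutations satisfy it. Cut the union of a pair at its \<open>t\<close> common elements into \<open>t + 1\<close>
  gaps and record in each gap the numbers \<open>a\<close>, \<open>b\<close> of elements that belong only to the first or only
  to the second tuple: the prescription is consistent exactly if both pairs have the same gap
  pattern (\<open>card_permutes_two_tuples\<close>). There are \<open>n choose m\<close> times the product of all
  \<open>(a + b) choose a\<close> pairs with a given pattern (\<open>card_words_gap_pattern\<close>), and this number enters
  squared. What remains is the coefficient of \<open>x^(k - t) y^(k - t)\<close> in the power \<open>t + 1\<close> of the series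
  with coefficients \<open>((a + b) choose a)\<^sup>2\<close>. That series is \<open>((1 - x - y)\<^sup>2 - 4 x y)\<close> to the power
  \<open>- 1 / 2\<close>, by a Vandermonde convolution, and expanding the power \<open>- (t + 1) / 2\<close> in terms of
  \<open>4 x y / (1 - x - y)\<^sup>2\<close> gives the sum over \<open>s\<close> (\<open>shuffle_conv_eq\<close>).

  Limit law. Almost surely, \<open>n\<close> independent uniform points of the unit square have distinct
  coordinates. The permutation that takes the rank of the abscissa of a point to the rank of its ordinate is
  uniform, and the increasing subsequences of length \<open>k\<close> are the chains of \<open>k\<close> points. So the law of
  \<open>Z n k\<close> is that of a U-statistic, the number of chains (\<open>distr_chain_count\<close>), and Hoeffding's
  method applies to it. Let the projection be the conditional mean of the kernel given one of its
  arguments. Subtracting from the centered kernel the centered projections of its arguments leaves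
  remainders, and two remainders are orthogonal unless they share two indices. Few pairs of index
  sets do, so the remainders contribute a variance of order at most \<open>n^(2 k - 2)\<close>, while the projections
  add up to \<open>(n - 1) choose (k - 1)\<close> times a sum of \<open>n\<close> independent identically distributed variables, with
  a variance of order \<open>n^(2 k - 1)\<close> unless the projection is constant. After standardization only
  the sum of projections survives, and the central limit theorem applies (\<open>ustat_clt\<close>). For
  \<open>k \<ge> 2\<close> the projection is not constant, since a point near the corner \<open>(0, 1)\<close> is rarely comparable to
  another one (\<open>projection_variance_chain_pos\<close>).
\<close>

section \<open>Permutations with prescribed values\<close>

text \<open>Two words with the same equality pattern are related by an injection from the letters of the
  first to the letters of the second. Complementing it by any bijection between the remaining
  letters of \<open>A\<close> gives a permutation.\<close>

lemma ex_permutes_map_eq: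
  assumes "finite A" "set u \<subseteq> A" "set v \<subseteq> A" "length u = length v"
    and pattern: "\<And>i j. i < length u \<Longrightarrow> j < length u \<Longrightarrow> u ! i = u ! j \<longleftrightarrow> v ! i = v ! j"
  shows "\<exists>\<sigma>. \<sigma> permutes A \<and> map \<sigma> u = v"
proof -
  define f where "f x = v ! (SOME i. i < length u \<and> u ! i = x)" for x
  have f: "f (u ! i) = v ! i" if "i < length u" for i
  proof -
    define j where "j = (SOME j. j < length u \<and> u ! j = u ! i)"
    have "j < length u \<and> u ! j = u ! i"
      unfolding j_def by (rule someI[of _ i]) (use that in auto)
    then show ?thesis
      using pattern[of j i] that unfolding f_def j_def by auto
  qed
  have "f ` set u = set v"
    using f assms(4) unfolding set_conv_nth by force
  moreover have "inj_on f (set u)"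
    using f pattern by (auto simp: inj_on_def in_set_conv_nth)
  ultimately have bij_f: "bij_betw f (set u) (set v)"
    by (simp add: bij_betw_def)
  then have "card (A - set u) = card (A - set v)"
    using assms(2,3) by (simp add: card_Diff_subset bij_betw_same_card)
  then obtain h where "bij_betw h (A - set u) (A - set v)"
    using assms(1) by (metis finite_Diff finite_same_card_bij)
  then have "bij_betw (\<lambda>x. if x \<in> set u then f x else h x) (set u \<union> (A - set u)) (set v \<union> (A - set v))"
    using bij_f by (intro bij_betw_disjoint_Un) auto
  then have bij: "bij_betw (\<lambda>x. if x \<in> set u then f x else h x) A A"
    using assms(2,3) by (simp add: Un_absorb1)
  define \<sigma> where "\<sigma> x = (if x \<in> A then if x \<in> set u then f x else h x else x)" for x
  have "bij_betw \<sigma> A A"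
    using bij by (rule bij_betw_cong[THEN iffD1, rotated]) (simp add: \<sigma>_def)
  then have "\<sigma> permutes A"
    by (rule bij_imp_permutes) (simp add: \<sigma>_def)
  moreover have "map \<sigma> u = v"
    using assms(2,4) f nth_mem[of _ u] by (intro nth_equalityI) (auto simp: \<sigma>_def subset_iff)
  ultimately show ?thesis by blast
qed

text \<open>Once one solution \<open>\<sigma>\<close> is known, every other one is \<open>\<sigma> \<circ> \<rho>\<close> with \<open>\<rho>\<close> fixing the letters of \<open>u\<close>,
  so the solutions correspond to the permutations of the other letters.\<close>

lemma card_permutes_map_eq:
  assumes "finite A" "set u \<subseteq> A" "set v \<subseteq> A" "length u = length v"
  shows "card {\<pi>. \<pi> permutes A \<and> map \<pi> u = v} =
    (if \<forall>i<length u. \<forall>j<length u. u ! i = u ! j \<longleftrightarrow> v ! i = v ! j then fact (card A - card (set u)) else 0)"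
proof (cases "\<forall>i<length u. \<forall>j<length u. u ! i = u ! j \<longleftrightarrow> v ! i = v ! j")
  case True
  then obtain \<sigma> where \<sigma>: "\<sigma> permutes A" "map \<sigma> u = v"
    using ex_permutes_map_eq[OF assms] by blast
  have "{\<pi>. \<pi> permutes A \<and> map \<pi> u = v} = (\<lambda>\<rho>. \<sigma> \<circ> \<rho>) ` {\<rho>. \<rho> permutes (A - set u)}"
  proof (intro equalityI subsetI)
    fix \<pi> assume \<pi>: "\<pi> \<in> {\<pi>. \<pi> permutes A \<and> map \<pi> u = v}"
    define \<rho> where "\<rho> = inv \<sigma> \<circ> \<pi>"
    have "\<rho> permutes A"
      unfolding \<rho>_def using \<pi> \<sigma> by (auto intro!: permutes_compose permutes_inv)
    moreover have "\<rho> x = x" if "x \<in> set u" for x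
      using \<sigma> \<pi> that permutes_inverses(2)[OF \<sigma>(1)] by (auto simp: \<rho>_def map_eq_conv[symmetric] simp del: map_eq_conv) (metis (no_types) map_eq_conv)
    ultimately have "\<rho> permutes (A - set u)"
      by (rule_tac permutes_superset) auto
    moreover have "\<pi> = \<sigma> \<circ> \<rho>"
      using permutes_inverses(1)[OF \<sigma>(1)] by (auto simp: \<rho>_def)
    ultimately show "\<pi> \<in> (\<lambda>\<rho>. \<sigma> \<circ> \<rho>) ` {\<rho>. \<rho> permutes (A - set u)}"
      by blast
  next
    fix \<pi> assume "\<pi> \<in> (\<lambda>\<rho>. \<sigma> \<circ> \<rho>) ` {\<rho>. \<rho> permutes (A - set u)}"
    then obtain \<rho> where \<rho>: "\<rho> permutes (A - set u)" "\<pi> = \<sigma> \<circ> \<rho>" by blast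
    then have "\<rho> permutes A" by (auto intro: permutes_subset)
    moreover have "map \<pi> u = map \<sigma> u"
      using \<rho> by (auto simp: permutes_not_in)
    ultimately show "\<pi> \<in> {\<pi>. \<pi> permutes A \<and> map \<pi> u = v}"
      using \<rho> \<sigma> by (auto intro: permutes_compose)
  qed
  moreover have "card ((\<lambda>\<rho>. \<sigma> \<circ> \<rho>) ` X) = card X" for X
    by (rule card_image) (use permutes_inj[OF \<sigma>(1)] in \<open>auto simp: inj_on_def fun_eq_iff\<close>)
  ultimately have "card {\<pi>. \<pi> permutes A \<and> map \<pi> u = v} = card {\<rho>. \<rho> permutes (A - set u)}"
    by (simp only:)
  also have "\<dots> = fact (card A - card (set u))"
    using assms by (subst card_permutations[OF refl]) (auto simp: card_Diff_subset)
  finally show ?thesis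
    using True by simp
next
  case False
  have "{\<pi>. \<pi> permutes A \<and> map \<pi> u = v} = {}"
  proof (rule ccontr)
    assume "{\<pi>. \<pi> permutes A \<and> map \<pi> u = v} \<noteq> {}"
    then obtain \<pi> where \<pi>: "\<pi> permutes A" "map \<pi> u = v" by blast
    then have "u ! i = u ! j \<longleftrightarrow> v ! i = v ! j" if "i < length u" "j < length u" for i j
      using that permutes_inj[OF \<pi>(1)] by (auto simp: inj_eq)
    with False show False by blast
  qed
  then have "card {\<pi>. \<pi> permutes A \<and> map \<pi> u = v} = 0" by (simp only: card.empty)
  then show ?thesis unfolding if_not_P[OF False] .
qed

section \<open>Index tuples and the mean\<close>

lemma finite_index_tuples [simp]: "finite (index_tuples n k)"
  by (rule finite_subset[OF _ finite_lists_length_eq[of "{1..n}" k]]) (auto simp: index_tuples_def)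

lemma bij_betw_index_tuples:
  "bij_betw set (index_tuples n k) {S. S \<subseteq> {1..n} \<and> card S = k}"
proof (rule bij_betw_byWitness[where f' = sorted_list_of_set])
  show "\<forall>is\<in>index_tuples n k. sorted_list_of_set (set is) = is"
    by (auto simp: index_tuples_def strict_sorted_iff intro: sorted_list_of_set.idem_if_sorted_distinct)
  show "\<forall>S\<in>{S. S \<subseteq> {1..n} \<and> card S = k}. set (sorted_list_of_set S) = S"
    by (auto dest: finite_subset)
  show "set ` index_tuples n k \<subseteq> {S. S \<subseteq> {1..n} \<and> card S = k}"
    by (auto simp: index_tuples_def strict_sorted_iff distinct_card)
  show "sorted_list_of_set ` {S. S \<subseteq> {1..n} \<and> card S = k} \<subseteq> index_tuples n k"
    by (auto simp: index_tuples_def finite_subset[OF _ finite_atLeastAtMost] subset_iff)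
qed

lemma card_index_tuples: "card (index_tuples n k) = n choose k"
  using bij_betw_same_card[OF bij_betw_index_tuples[of n k]] n_subsets[of "{1..n}" k] by simp

lemma expectation_uniform_permutation:
  "measure_pmf.expectation (uniform_permutation n) f = (\<Sum>\<pi>\<in>{\<pi>. \<pi> permutes {1..n}}. f \<pi>) / fact n"
  for f :: "_ \<Rightarrow> real"
proof -
  have "{\<pi>. \<pi> permutes {1..n}} \<noteq> {}" using permutes_id by blast
  then show ?thesis
    unfolding uniform_permutation_def
    by (subst integral_pmf_of_set) (simp_all add: finite_permutations card_permutations)
qed

lemma map_permutes_in_index_tuples:
  assumes "\<pi> permutes {1..n}" "is \<in> index_tuples n k"
  shows "map \<pi> is \<in> index_tuples n k \<longleftrightarrow> sorted_wrt (<) (map \<pi> is)"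
  using assms permutes_in_image[OF assms(1)] by (auto simp: index_tuples_def)

text \<open>Splitting by the image tuple replaces the order condition by prescribed values, which is what
  \<open>card_permutes_map_eq\<close> counts.\<close>

lemma sum_permutes_sorted:
  assumes "\<pi> permutes {1..n}" "is \<in> index_tuples n k"
  shows "of_bool (sorted_wrt (<) (map \<pi> is)) = (\<Sum>is'\<in>index_tuples n k. of_bool (map \<pi> is = is') :: 'a :: semiring_1)"
proof -
  have "(\<Sum>is'\<in>index_tuples n k. of_bool (map \<pi> is = is') :: 'a) = 
        (\<Sum>is'\<in>index_tuples n k. if map \<pi> is = is' then 1 else 0)"
    by (intro sum.cong) auto
  also have "\<dots> = of_bool (sorted_wrt (<) (map \<pi> is))"
    using map_permutes_in_index_tuples[OF assms] by (subst sum.delta') auto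
  finally show ?thesis ..
qed

text \<open>There are \<open>(n choose k)\<^sup>2\<close> choices of an index tuple and its image, and each is realized by
  \<open>(n - k)!\<close> permutations.\<close>

lemma mean_Z_eq: "mean_Z n k = real (n choose k) * (1 / fact k)"
proof -
  let ?P = "{\<pi>. \<pi> permutes {1..n}}" and ?I = "index_tuples n k"
  have "(\<Sum>\<pi>\<in>?P. Z n k \<pi>) = (\<Sum>\<pi>\<in>?P. \<Sum>is\<in>?I. \<Sum>is'\<in>?I. of_bool (map \<pi> is = is'))"
    unfolding Z_def by (intro sum.cong refl) (auto simp: sum_permutes_sorted)
  also have "\<dots> = (\<Sum>is\<in>?I. \<Sum>is'\<in>?I. \<Sum>\<pi>\<in>?P. of_bool (map \<pi> is = is'))"
    by (subst sum.swap, intro sum.cong refl, subst sum.swap, rule refl)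
  also have "\<dots> = (\<Sum>is\<in>?I. \<Sum>is'\<in>?I. fact (n - k))"
  proof (intro sum.cong refl)
    fix "is" is' assume *: "is \<in> ?I" "is' \<in> ?I"
    have "(\<Sum>\<pi>\<in>?P. of_bool (map \<pi> is = is') :: real) = real (card {\<pi>. \<pi> permutes {1..n} \<and> map \<pi> is = is'})"
      by (simp add: finite_permutations Int_def)
    also have "card {\<pi>. \<pi> permutes {1..n} \<and> map \<pi> is = is'} = fact (n - k)"
      using * by (subst card_permutes_map_eq)
        (auto simp: index_tuples_def strict_sorted_iff nth_eq_iff_index_eq distinct_card)
    finally show "(\<Sum>\<pi>\<in>?P. of_bool (map \<pi> is = is') :: real) = fact (n - k)" by simp
  qed
  also have "\<dots> = real (n choose k) * (real (n choose k) * fact (n - k))"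
    by (simp add: card_index_tuples)
  finally have *: "mean_Z n k = real (n choose k) * (real (n choose k) * fact (n - k)) / fact n"
    by (simp add: expectation_uniform_permutation)
  show ?thesis
  proof (cases "k \<le> n")
    case True
    then show ?thesis
      unfolding * by (simp add: binomial_fact)
  qed (simp add: * binomial_eq_0)
qed

section \<open>Gap patterns of pairs of index tuples\<close>

text \<open>The offset \<open>i\<close> is the position of the head of the word, so that the recursion produces absolute
  positions.\<close>

fun true_positions :: "nat \<Rightarrow> bool list \<Rightarrow> nat list" where
  "true_positions i [] = []"
| "true_positions i (p # ps) = (if p then [i] else []) @ true_positions (Suc i) ps"

lemma set_true_positions: "set (true_positions i ps) = {i + j | j. j < length ps \<and> ps ! j}"
proof (induction i ps rule: true_positions.induct)
  case (2 i p ps)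
  have "{i + j | j. j < length (p # ps) \<and> (p # ps) ! j} =
     (if p then {i} else {}) \<union> {Suc i + j | j. j < length ps \<and> ps ! j}" (is "?L = ?R")
  proof (intro equalityI subsetI)
    fix x assume "x \<in> ?L"
    then obtain j where "x = i + j" "j < length (p # ps)" "(p # ps) ! j" by blast
    then show "x \<in> ?R" by (cases j) auto
  next
    fix x assume "x \<in> ?R"
    then consider "x = i" p | j where "x = Suc i + j" "j < length ps" "ps ! j"
      by (auto split: if_splits)
    then show "x \<in> ?L"
    proof cases
      case 1 then show ?thesis by (auto intro!: exI[of _ 0])
    next
      case 2 then show ?thesis by (auto intro!: exI[of _ "Suc j"])
    qed
  qed
  then show ?case using 2 by simp
qed simp

lemma sorted_true_positions: "sorted_wrt (<) (true_positions i ps)"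
  by (induction i ps rule: true_positions.induct) (auto simp: set_true_positions)

lemma true_positions_map: "true_positions i (map P [i..<i + n]) = filter P [i..<i + n]"
proof (induction n arbitrary: i)
  case (Suc n)
  show ?case using Suc[of "Suc i"] by (simp add: upt_conv_Cons del: upt_Suc)
qed simp

definition pair_word :: "nat \<Rightarrow> nat list \<times> nat list \<Rightarrow> (bool \<times> bool) list" where
  "pair_word n p = map (\<lambda>i. (i \<in> set (fst p), i \<in> set (snd p))) [1..<Suc n]"

definition word_pair :: "(bool \<times> bool) list \<Rightarrow> nat list \<times> nat list" where
  "word_pair w = (true_positions 1 (map fst w), true_positions 1 (map snd w))"

text \<open>A pair of subsets of \<open>{1..n}\<close> is recorded as a word of length \<open>n\<close> over \<open>bool \<times> bool\<close>: the letter
  at position \<open>i\<close> tells whether \<open>i\<close> belongs to the first and to the second subset. Words can be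
  taken apart letter by letter, which makes induction possible.\<close>

definition pair_words :: "nat \<Rightarrow> nat \<Rightarrow> (bool \<times> bool) list set" where
  "pair_words n k = {w. length w = n \<and> length (fst (word_pair w)) = k \<and> length (snd (word_pair w)) = k}"

lemma bij_betw_word_pair: "bij_betw word_pair (pair_words n k) (index_tuples n k \<times> index_tuples n k)"
proof (rule bij_betw_byWitness[where f' = "pair_word n"])
  have *: "map (\<lambda>i. i \<in> set (true_positions 1 ps)) [1..<Suc (length ps)] = ps" for ps
    by (rule nth_equalityI) (auto simp: set_true_positions simp del: upt_Suc)
  show "\<forall>w\<in>pair_words n k. pair_word n (word_pair w) = w"
  proof
    fix w assume "w \<in> pair_words n k"
    then have "length w = n" by (simp add: pair_words_def)
    have "map fst (pair_word n (word_pair w)) = map fst w"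
      using *[of "map fst w"] \<open>length w = n\<close> by (simp add: pair_word_def word_pair_def comp_def del: upt_Suc)
    moreover have "map snd (pair_word n (word_pair w)) = map snd w"
      using *[of "map snd w"] \<open>length w = n\<close> by (simp add: pair_word_def word_pair_def comp_def del: upt_Suc)
    ultimately show "pair_word n (word_pair w) = w"
      by (metis zip_map_fst_snd)
  qed
  have **: "true_positions 1 (map (\<lambda>i. i \<in> set is) [1..<Suc n]) = is" if "is \<in> index_tuples n k" for "is"
  proof -
    have "filter (\<lambda>i. i \<in> set is) [1..<Suc n] = is"
      using that by (intro sorted_distinct_set_unique)
        (auto simp: index_tuples_def strict_sorted_iff subset_iff sorted_wrt_filter simp del: upt_Suc)
    then show ?thesis using true_positions_map[of 1 _ n] by (simp del: upt_Suc)
  qed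
  show ***: "\<forall>p\<in>index_tuples n k \<times> index_tuples n k. word_pair (pair_word n p) = p"
    using ** by (auto simp: pair_word_def word_pair_def comp_def simp del: upt_Suc)
  show "word_pair ` pair_words n k \<subseteq> index_tuples n k \<times> index_tuples n k"
    using sorted_true_positions[of 1]
    by (auto simp: pair_words_def word_pair_def index_tuples_def set_true_positions)
  show "pair_word n ` (index_tuples n k \<times> index_tuples n k) \<subseteq> pair_words n k"
    using *** by (auto simp: pair_words_def) (auto simp: pair_word_def index_tuples_def)
qed

text \<open>A permutation that maps the tuples \<open>xs\<close>, \<open>ys\<close> to \<open>xs'\<close>, \<open>ys'\<close> exists exactly when the two pairs
  coincide at the same places; this set of places is the only information about a pair that the
  count of permutations needs besides the size of the union.\<close>

definition coincidences :: "nat list \<Rightarrow> nat list \<Rightarrow> (nat \<times> nat) set" where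
  "coincidences xs ys = {(a, b). a < length xs \<and> b < length ys \<and> xs ! a = ys ! b}"

lemma coincidences_swap: "coincidences xs ys = {(a, b). (b, a) \<in> coincidences ys xs}"
  by (auto simp: coincidences_def)

lemma coincidences_Cons_left:
  assumes "x \<notin> set ys"
  shows "coincidences (x # xs) ys = (\<lambda>(a, b). (Suc a, b)) ` coincidences xs ys"
proof (intro equalityI subsetI)
  fix p assume "p \<in> coincidences (x # xs) ys"
  then obtain a b where p: "p = (a, b)" "a < Suc (length xs)" "b < length ys" "(x # xs) ! a = ys ! b"
    by (auto simp: coincidences_def)
  with assms obtain a' where "a = Suc a'" by (cases a) auto
  with p have "(a', b) \<in> coincidences xs ys" by (simp add: coincidences_def)
  then show "p \<in> (\<lambda>(a, b). (Suc a, b)) ` coincidences xs ys"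
    using p \<open>a = Suc a'\<close> by force
qed (auto simp: coincidences_def)

lemma coincidences_Cons_right:
  assumes "y \<notin> set xs"
  shows "coincidences xs (y # ys) = (\<lambda>(a, b). (a, Suc b)) ` coincidences xs ys"
  unfolding coincidences_swap[of xs] coincidences_Cons_left[OF assms]
  by force

lemma coincidences_Cons_both:
  assumes "x \<notin> set xs" "x \<notin> set ys"
  shows "coincidences (x # xs) (x # ys) = insert (0, 0) ((\<lambda>(a, b). (Suc a, Suc b)) ` coincidences xs ys)"
proof (intro equalityI subsetI)
  fix p assume "p \<in> coincidences (x # xs) (x # ys)"
  then obtain a b where p: "p = (a, b)" "a < Suc (length xs)" "b < Suc (length ys)" "(x # xs) ! a = (x # ys) ! b"
    by (auto simp: coincidences_def)
  show "p \<in> insert (0, 0) ((\<lambda>(a, b). (Suc a, Suc b)) ` coincidences xs ys)"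
  proof (cases "a = 0 \<or> b = 0")
    case True
    then have "a = 0" "b = 0" using p assms nth_mem[of "a - 1" xs] nth_mem[of "b - 1" ys]
      by (auto simp: nth_Cons split: nat.splits)
    then show ?thesis using p by simp
  next
    case False
    then obtain a' b' where ab: "a = Suc a'" "b = Suc b'" by (metis not0_implies_Suc)
    with p have "(a', b') \<in> coincidences xs ys" by (simp add: coincidences_def)
    then show ?thesis using p ab by force
  qed
qed (auto simp: coincidences_def)

text \<open>The letters \<open>(True, True)\<close> cut a word into gaps. The pattern lists, for each gap, how many
  letters \<open>(True, False)\<close> and how many letters \<open>(False, True)\<close> it contains; it has one entry more
  than there are common elements, and it ignores the letters \<open>(False, False)\<close>.\<close>

fun gap_pattern :: "(bool \<times> bool) list \<Rightarrow> (nat \<times> nat) list" where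
  "gap_pattern [] = [(0, 0)]"
| "gap_pattern ((True, True) # w) = (0, 0) # gap_pattern w"
| "gap_pattern ((False, False) # w) = gap_pattern w"
| "gap_pattern ((True, False) # w) = (let g = gap_pattern w in (Suc (fst (hd g)), snd (hd g)) # tl g)"
| "gap_pattern ((False, True) # w) = (let g = gap_pattern w in (fst (hd g), Suc (snd (hd g))) # tl g)"

lemma gap_pattern_neq_Nil [simp]: "gap_pattern w \<noteq> []"
  by (induction w rule: gap_pattern.induct) (auto simp: Let_def)

text \<open>The coincidence places can be read off the gap pattern: each common element sits at the
  running totals of the preceding gaps, shifted by the number of preceding common elements.\<close>

fun gap_coincidences :: "(nat \<times> nat) list \<Rightarrow> (nat \<times> nat) set" where
  "gap_coincidences ((a, b) # g # gs) = insert (a, b) ((\<lambda>(x, y). (x + Suc a, y + Suc b)) ` gap_coincidences (g # gs))"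
| "gap_coincidences _ = {}"

lemma gap_coincidences_Suc_fst:
  "gap_coincidences ((Suc a, b) # gs) = (\<lambda>(x, y). (Suc x, y)) ` gap_coincidences ((a, b) # gs)"
  by (cases gs) (auto simp: image_iff)

lemma gap_coincidences_Suc_snd:
  "gap_coincidences ((a, Suc b) # gs) = (\<lambda>(x, y). (x, Suc y)) ` gap_coincidences ((a, b) # gs)"
  by (cases gs) (auto simp: image_iff)

lemma coincidences_true_positions:
  "coincidences (true_positions i (map fst w)) (true_positions i (map snd w)) = gap_coincidences (gap_pattern w)"
proof (induction w arbitrary: i rule: gap_pattern.induct)
  case 1
  then show ?case by (simp add: coincidences_def)
next
  case (2 w)
  obtain g gs where g: "gap_pattern w = g # gs" by (cases "gap_pattern w") auto
  show ?case
    using 2[of "Suc i"] by (simp add: coincidences_Cons_both set_true_positions g)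
next
  case (4 w)
  obtain a b gs where g: "gap_pattern w = (a, b) # gs" by (cases "gap_pattern w") auto
  show ?case
    using 4[of "Suc i"] by (simp add: coincidences_Cons_left set_true_positions g gap_coincidences_Suc_fst)
next
  case (5 w)
  obtain a b gs where g: "gap_pattern w = (a, b) # gs" by (cases "gap_pattern w") auto
  show ?case
    using 5[of "Suc i"] by (simp add: coincidences_Cons_right set_true_positions g gap_coincidences_Suc_snd)
next
  case (3 w)
  show ?case using 3[of "Suc i"] by simp
qed

abbreviation gap_total1 :: "(nat \<times> nat) list \<Rightarrow> nat" where
  "gap_total1 g \<equiv> sum_list (map fst g) + (length g - 1)"

abbreviation gap_total2 :: "(nat \<times> nat) list \<Rightarrow> nat" where
  "gap_total2 g \<equiv> sum_list (map snd g) + (length g - 1)"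

lemma length_true_positions_gap:
  "length (true_positions i (map fst w)) = gap_total1 (gap_pattern w) \<and>
   length (true_positions i (map snd w)) = gap_total2 (gap_pattern w)"
proof (induction w arbitrary: i rule: gap_pattern.induct)
  case (2 w)
  obtain a b gs where g: "gap_pattern w = (a, b) # gs" by (cases "gap_pattern w") auto
  show ?case using 2[of "Suc i"] by (simp add: g)
next
  case (4 w)
  obtain a b gs where g: "gap_pattern w = (a, b) # gs" by (cases "gap_pattern w") auto
  show ?case using 4[of "Suc i"] by (simp add: g)
next
  case (5 w)
  obtain a b gs where g: "gap_pattern w = (a, b) # gs" by (cases "gap_pattern w") auto
  show ?case using 5[of "Suc i"] by (simp add: g)
next
  case (3 w)
  show ?case using 3[of "Suc i"] by simp
qed simp

text \<open>Conversely the pattern can be recovered. The first gap is the componentwise least coincidence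
  place, so the gaps can be peeled off one after the other; the last gap leaves no coincidence
  and is determined by the lengths of the two tuples.\<close>

lemma gap_coincidences_inject:
  assumes "g \<noteq> []" "g' \<noteq> []" "gap_coincidences g = gap_coincidences g'"
    "gap_total1 g = gap_total1 g'" "gap_total2 g = gap_total2 g'"
  shows "g = g'"
  using assms
proof (induction g arbitrary: g' rule: gap_coincidences.induct)
  case (1 a b h hs)
  obtain a' b' h' hs' where g': "g' = (a', b') # h' # hs'"
    using 1(3,4) by (cases g' rule: gap_coincidences.cases) auto
  note eq = "1.prems"(3)[unfolded g']
  have "(a, b) \<in> gap_coincidences ((a, b) # h # hs)" "(a', b') \<in> gap_coincidences ((a', b') # h' # hs')"
    by simp_all
  then have "(a, b) \<in> gap_coincidences ((a', b') # h' # hs')" "(a', b') \<in> gap_coincidences ((a, b) # h # hs)"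
    by (simp_all only: eq)
  then have "a' \<le> a \<and> b' \<le> b" "a \<le> a' \<and> b \<le> b'" by auto
  then have ab: "a' = a" "b' = b" by auto
  let ?f = "\<lambda>(x, y). (x + Suc a, y + Suc b)"
  have ins: "insert (a, b) (?f ` gap_coincidences (h # hs)) = insert (a, b) (?f ` gap_coincidences (h' # hs'))"
    using eq unfolding ab gap_coincidences.simps .
  have notin: "(a, b) \<notin> ?f ` X" for X by auto
  have "?f ` gap_coincidences (h # hs) = ?f ` gap_coincidences (h' # hs')"
    using ins unfolding insert_ident[OF notin notin] .
  moreover have "inj ?f" by (auto simp: inj_def)
  ultimately have *: "gap_coincidences (h # hs) = gap_coincidences (h' # hs')"
    unfolding inj_image_eq_iff[OF \<open>inj ?f\<close>] by blast
  have "gap_total1 (h # hs) = gap_total1 (h' # hs')" "gap_total2 (h # hs) = gap_total2 (h' # hs')"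
    using "1.prems"(4,5) by (simp_all add: g' ab)
  with * have "h # hs = h' # hs'"
    by (intro "1.IH") simp_all
  then show ?case by (simp add: g' ab)
next
  case ("2_2" x)
  then obtain p' where "g' = [p']" by (cases g' rule: gap_coincidences.cases) auto
  then show ?case using "2_2" by (auto simp: prod_eq_iff)
qed auto

section \<open>Convolution powers of squared binomial coefficients\<close>

text \<open>The \<open>r\<close>-th convolution power of the array of squared binomial coefficients, that is, the
  coefficient of \<open>x^a y^b\<close> in the \<open>r\<close>-th power of the sum of all \<open>((a + b) choose a)\<^sup>2 x^a y^b\<close>.\<close>

fun shuffle_conv :: "nat \<Rightarrow> nat \<Rightarrow> nat \<Rightarrow> nat" where
  "shuffle_conv 0 a b = of_bool (a = 0 \<and> b = 0)"
| "shuffle_conv (Suc r) a b =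
     (\<Sum>a'\<le>a. \<Sum>b'\<le>b. ((a' + b') choose a')\<^sup>2 * shuffle_conv r (a - a') (b - b'))"

text \<open>The generating function in two variables is homogenized: \<open>x\<close> becomes \<open>q X\<close> with a real parameter
  \<open>q\<close> and \<open>y\<close> becomes \<open>X\<close>. This leaves a power series in one variable, and since \<open>q\<close> is arbitrary,
  comparing polynomials in \<open>q\<close> recovers the coefficients in two variables.\<close>

definition shuffle_fps :: "real \<Rightarrow> real fps" where
  "shuffle_fps q = Abs_fps (\<lambda>n. \<Sum>a\<le>n. real ((n choose a)\<^sup>2) * q ^ a)"

lemma shuffle_fps_power_nth:
  "(shuffle_fps q ^ r) $ n = (\<Sum>a\<le>n. real (shuffle_conv r a (n - a)) * q ^ a)"
proof (induction r arbitrary: n)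
  case 0
  have "(\<Sum>a\<le>n. real (shuffle_conv 0 a (n - a)) * q ^ a) = (\<Sum>a\<in>{..n}. if a = 0 then of_bool (n = 0) else 0)"
    by (intro sum.cong) auto
  then show ?case by simp
next
  case (Suc r)
  have "(shuffle_fps q ^ Suc r) $ n = (\<Sum>i=0..n. shuffle_fps q $ i * (shuffle_fps q ^ r) $ (n - i))"
    by (simp add: fps_mult_nth)
  also have "\<dots> =
     (\<Sum>i=0..n. (\<Sum>a'\<le>i. real ((i choose a')\<^sup>2) * q ^ a') *
        (\<Sum>a\<le>n-i. real (shuffle_conv r a (n - i - a)) * q ^ a))"
    unfolding Suc.IH by (simp add: shuffle_fps_def)
  also have "\<dots> = (\<Sum>i\<in>{0..n}. \<Sum>(a',a)\<in>{..i}\<times>{..n-i}.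
       real ((i choose a')\<^sup>2) * real (shuffle_conv r a (n - i - a)) * q ^ (a' + a))"
    by (simp add: sum_product sum.cartesian_product power_add mult_ac)
  also have "\<dots> = (\<Sum>(i,a',a)\<in>(SIGMA i:{0..n}. {..i}\<times>{..n-i}).
       real ((i choose a')\<^sup>2) * real (shuffle_conv r a (n - i - a)) * q ^ (a' + a))"
    by (subst sum.Sigma) (auto simp: case_prod_unfold)
  also have "\<dots> = (\<Sum>(a,a',b')\<in>(SIGMA a:{..n}. {..a}\<times>{..n-a}).
       real (((a'+b') choose a')\<^sup>2) * real (shuffle_conv r (a-a') (n - a - b')) * q ^ a)"
    by (rule sum.reindex_bij_witness[where j="\<lambda>(i,a',a). (a'+a, a', i-a')" 
          and i="\<lambda>(a,a',b'). (a'+b', a', a-a')"])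
       (auto simp: diff_diff_add intro!: arg_cong2[where f="shuffle_conv r"])
  also have "\<dots> = (\<Sum>a\<le>n. (\<Sum>(a',b')\<in>{..a}\<times>{..n-a}.
       real (((a'+b') choose a')\<^sup>2) * real (shuffle_conv r (a-a') (n - a - b')) * q ^ a))"
    by (subst sum.Sigma) (auto simp: case_prod_unfold)
  also have "\<dots> = (\<Sum>a\<le>n. real (shuffle_conv (Suc r) a (n - a)) * q ^ a)"
    by (simp add: sum.cartesian_product[symmetric] sum_distrib_right)
  finally show ?case .
qed

text \<open>The homogenized form of \<open>1 / (1 - x - y)\<close>.\<close>

definition geom_fps :: "real \<Rightarrow> real fps" where
  "geom_fps q = inverse (1 - fps_const (1 + q) * fps_X)"

lemma geom_fps_power_nth:
  "(geom_fps q ^ r) $ n = real ((n + r - 1) choose n) * (1 + q) ^ n"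
proof (cases "r = 0")
  case False
  then show ?thesis
    using one_minus_const_fps_X_neg_power'[of r "1 + q"]
    by (simp add: geom_fps_def fps_inverse_power add.commute[of n r])
qed (cases n; simp)

text \<open>The homogenized form of \<open>((1 - x - y)\<^sup>2 - 4 x y)\<close> to the power \<open>- r / 2\<close>, written as
  \<open>(1 - x - y)\<close> to the power \<open>- r\<close> times the binomial series of exponent \<open>- r / 2\<close> at
  \<open>- 4 x y / (1 - x - y)\<^sup>2\<close>. For \<open>r = 1\<close> it is the generating function of the Legendre polynomials
  up to a change of variables.\<close>

definition legendre_fps :: "nat \<Rightarrow> real \<Rightarrow> real fps" where
  "legendre_fps r q = geom_fps q ^ r * (fps_binomial (- real r / 2) oo (fps_const (- 4 * q) * fps_X ^ 2 * geom_fps q ^ 2))"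

lemma legendre_fps_power: "legendre_fps 1 q ^ r = legendre_fps r q"
proof -
  have *: "fps_binomial (- real 1 / 2) ^ r = fps_binomial (- real r / 2)"
    by (simp add: fps_binomial_power)
  show ?thesis
    unfolding legendre_fps_def power_mult_distrib
    by (subst fps_compose_power) (simp_all only: *, simp_all)
qed

text \<open>The coefficient of \<open>x^a y^b\<close> in \<open>((1 - x - y)\<^sup>2 - 4 x y)\<close> to the power \<open>- r / 2\<close>. The index \<open>s\<close> comes
  from the binomial series, and the last two factors form the coefficient of
  \<open>x^(a - s) y^(b - s)\<close> in \<open>(1 - x - y)\<close> to the power \<open>- (r + 2 s)\<close>.\<close>

definition legendre_coeff :: "nat \<Rightarrow> nat \<Rightarrow> nat \<Rightarrow> real" where
  "legendre_coeff r a b = (\<Sum>s\<le>min a b. ((real s + real r / 2 - 1) gchoose s) * 4 ^ s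
      * real ((a + b - 2 * s) choose (a - s)) * real ((a + b + r - 1) choose (a + b - 2 * s)))"

text \<open>The binomial series is expanded term by term. Its argument has order two in \<open>X\<close>, so only
  finitely many terms contribute to a coefficient.\<close>

lemma legendre_fps_nth:
  "legendre_fps r q $ n = (\<Sum>s\<in>{s. 2 * s \<le> n}. ((real s + real r / 2 - 1) gchoose s) * 4 ^ s * q ^ s
      * (1 + q) ^ (n - 2 * s) * real ((n + r - 1) choose (n - 2 * s)))"
proof -
  define z where "z = fps_const (- 4 * q) * fps_X ^ 2 * geom_fps q ^ 2"
  have z0: "z $ 0 = 0" by (simp add: z_def)
  define f where "f = fps_binomial (- real r / 2)"
  have zpow: "(geom_fps q ^ r * z ^ s) $ n = (if n < 2 * s then 0 else
       (- 4 * q) ^ s * real ((n + r - 1) choose (n - 2 * s)) * (1 + q) ^ (n - 2 * s))" for s n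
  proof -
    have "geom_fps q ^ r * z ^ s = fps_const ((- 4 * q) ^ s) * (fps_X ^ (2 * s) * geom_fps q ^ (2 * s + r))"
      unfolding z_def power_mult_distrib fps_const_power power_add power_mult[symmetric]
      by (simp only: mult_ac)
    then show ?thesis
      by (auto simp: fps_X_power_mult_nth geom_fps_power_nth)
  qed
  have "legendre_fps r q $ n = (\<Sum>i=0..n. (geom_fps q ^ r) $ i * (f oo z) $ (n - i))"
    by (simp add: legendre_fps_def f_def z_def fps_mult_nth)
  also have "\<dots> = (\<Sum>i=0..n. (geom_fps q ^ r) $ i * (\<Sum>s=0..n. f $ s * (z ^ s) $ (n - i)))"
    unfolding fps_compose_nth
    by (intro sum.cong refl arg_cong2[where f="(*)"] sum.mono_neutral_left)
       (auto simp: startsby_zero_power_prefix[OF z0])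
  also have "\<dots> = (\<Sum>s=0..n. f $ s * (geom_fps q ^ r * z ^ s) $ n)"
    unfolding fps_mult_nth sum_distrib_left by (subst sum.swap) (simp add: mult_ac)
  also have "\<dots> = (\<Sum>s\<in>{s. 2 * s \<le> n}. f $ s * (geom_fps q ^ r * z ^ s) $ n)"
    by (rule sum.mono_neutral_right) (auto simp: zpow)
  also have "\<dots> = (\<Sum>s\<in>{s. 2 * s \<le> n}. ((real s + real r / 2 - 1) gchoose s) * 4 ^ s * q ^ s
      * (1 + q) ^ (n - 2 * s) * real ((n + r - 1) choose (n - 2 * s)))"
  proof (intro sum.cong refl)
    fix s assume "s \<in> {s. 2 * s \<le> n}"
    have "f $ s * (- 1) ^ s = ((real s + real r / 2 - 1) gchoose s)"
      using gbinomial_minus[of "real r / 2" s]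
      by (simp add: f_def algebra_simps power_mult_distrib[symmetric])
    moreover have "(- 4 * q) ^ s = (- 1) ^ s * 4 ^ s * q ^ s"
      by (simp flip: power_mult_distrib)
    ultimately show "f $ s * (geom_fps q ^ r * z ^ s) $ n = ((real s + real r / 2 - 1) gchoose s) * 4 ^ s * q ^ s
      * (1 + q) ^ (n - 2 * s) * real ((n + r - 1) choose (n - 2 * s))"
      using \<open>s \<in> _\<close> unfolding zpow by (simp add: mult_ac)
  qed
  finally show ?thesis .
qed

text \<open>Expanding \<open>(1 + q) ^ (n - 2 * s)\<close> collects the powers of \<open>q\<close>.\<close>

lemma legendre_fps_nth':
  "legendre_fps r q $ n = (\<Sum>a\<le>n. legendre_coeff r a (n - a) * q ^ a)"
proof -
  define c where "c s = ((real s + real r / 2 - 1) gchoose s) * 4 ^ s * real ((n + r - 1) choose (n - 2 * s))" for s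
  have "legendre_fps r q $ n = (\<Sum>s\<in>{s. 2 * s \<le> n}. \<Sum>j\<in>{..n - 2 * s}. c s * real ((n - 2 * s) choose j) * q ^ (s + j))"
    unfolding legendre_fps_nth c_def using binomial_ring[of q 1]
    by (intro sum.cong) (auto simp: add.commute[of 1 q] sum_distrib_left power_add mult_ac)
  also have "\<dots> = (\<Sum>(s,j)\<in>(SIGMA s:{s. 2 * s \<le> n}. {..n - 2 * s}). c s * real ((n - 2 * s) choose j) * q ^ (s + j))"
    by (subst sum.Sigma) (auto intro: finite_subset[of _ "{..n}"])
  also have "\<dots> = (\<Sum>(a,s)\<in>(SIGMA a:{..n}. {..min a (n - a)}). c s * real ((n - 2 * s) choose (a - s)) * q ^ a)"
    by (rule sum.reindex_bij_witness[where j="\<lambda>(s,j). (s + j, s)" and i="\<lambda>(a,s). (s, a - s)"]) auto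
  also have "\<dots> = (\<Sum>a\<le>n. \<Sum>s\<le>min a (n - a). c s * real ((n - 2 * s) choose (a - s)) * q ^ a)"
    by (subst sum.Sigma) auto
  also have "\<dots> = (\<Sum>a\<le>n. legendre_coeff r a (n - a) * q ^ a)"
    by (intro sum.cong) (auto simp: legendre_coeff_def c_def sum_distrib_right sum_distrib_left mult_ac)
  finally show ?thesis .
qed

text \<open>This is the central binomial coefficient as a coefficient of the binomial series of exponent
  \<open>- 1 / 2\<close>.\<close>

lemma gchoose_half: "((real s - 1 / 2) gchoose s) * 4 ^ s = real ((2 * s) choose s)"
proof (induction s)
  case (Suc s)
  have "real (Suc s) * ((real (Suc s) - 1 / 2) gchoose Suc s) = (real s + 1 / 2) * ((real s - 1 / 2) gchoose s)"
    using gbinomial_absorption[of s "real (Suc s) - 1 / 2"] by (simp add: algebra_simps)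
  then have "4 * 4 ^ s * (real (Suc s) * ((real (Suc s) - 1 / 2) gchoose Suc s)) = 4 * 4 ^ s * ((real s + 1 / 2) * ((real s - 1 / 2) gchoose s))"
    by (rule arg_cong)
  then have "real (Suc s) * (((real (Suc s) - 1 / 2) gchoose Suc s) * 4 ^ Suc s) = (4 * real s + 2) * (((real s - 1 / 2) gchoose s) * 4 ^ s)"
    by (simp add: algebra_simps)
  also have "\<dots> = (4 * real s + 2) * real ((2 * s) choose s)"
    by (simp only: Suc.IH)
  also have "\<dots> = real (Suc s) * real ((2 * Suc s) choose Suc s)"
  proof -
    have "real ((2 * s) choose s) = fact (2 * s) / (fact s * fact s)"
      "real ((2 * Suc s) choose Suc s) = fact (2 * Suc s) / (fact (Suc s) * fact (Suc s))"
      by (subst binomial_fact; simp)+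
    moreover have "fact (2 * Suc s) = real (2 * s + 2) * real (2 * s + 1) * fact (2 * s)"
      by (simp add: algebra_simps)
    moreover have "(fact (Suc s) :: real) = real (Suc s) * fact s"
      by simp
    moreover have "real (Suc s) \<noteq> 0" "real (2 * s + 2) = 2 * real (Suc s)" "real (2 * s + 1) * 2 = 4 * real s + 2"
      by auto
    ultimately show ?thesis
      by (simp only: nonzero_mult_divide_mult_cancel_left mult.assoc times_divide_eq_right) (simp add: divide_simps)
  qed
  finally show ?case
    by (metis mult_left_cancel of_nat_eq_0_iff nat.distinct(1))
qed simp

text \<open>Writing all binomials as factorials, the summand is \<open>(a + b) choose a\<close> times
  \<open>(a choose s) * (b choose s)\<close>, and the sum over \<open>s\<close> is a Vandermonde convolution.\<close>

lemma legendre_coeff_1: "legendre_coeff 1 a b = real (((a + b) choose a)\<^sup>2)"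
proof -
  have "((real s + real 1 / 2 - 1) gchoose s) * 4 ^ s = real ((2 * s) choose s)" for s
    using gchoose_half[of s] by simp
  moreover have "real ((2 * s) choose s) * real ((a + b - 2 * s) choose (a - s)) * real ((a + b) choose (a + b - 2 * s))
     = real ((a + b) choose a) * (real (a choose s) * real (b choose (b - s)))" if "s \<le> min a b" for s
  proof -
    have s: "s \<le> a" "s \<le> b" "a + b - (a + b - 2 * s) = 2 * s" "a + b - 2 * s - (a - s) = b - s" "a + b - a = b"
      "2 * s - s = s" "b - (b - s) = s" using that by auto
    have "real ((2 * s) choose s) = fact (2 * s) / (fact s * fact s)"
      "real ((a + b - 2 * s) choose (a - s)) = fact (a + b - 2 * s) / (fact (a - s) * fact (b - s))"
      "real ((a + b) choose (a + b - 2 * s)) = fact (a + b) / (fact (a + b - 2 * s) * fact (2 * s))"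
      "real ((a + b) choose a) = fact (a + b) / (fact a * fact b)"
      "real (a choose s) = fact a / (fact s * fact (a - s))"
      "real (b choose (b - s)) = fact b / (fact (b - s) * fact s)"
      using s(1,2) by (subst binomial_fact; simp only: s; simp; fail)+
    then show ?thesis
      by (simp only:) (simp add: field_simps)
  qed
  ultimately have "legendre_coeff 1 a b = real ((a + b) choose a) * (\<Sum>s\<le>min a b. real (a choose s) * real (b choose (b - s)))"
    unfolding legendre_coeff_def sum_distrib_left by (intro sum.cong) auto
  also have "(\<Sum>s\<le>min a b. real (a choose s) * real (b choose (b - s))) = (\<Sum>s\<le>b. real (a choose s) * real (b choose (b - s)))"
    by (rule sum.mono_neutral_left) auto
  also have "\<dots> = real ((a + b) choose b)"
    by (simp flip: vandermonde[of a b b])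
  also have "(a + b) choose b = (a + b) choose a"
    using binomial_symmetric[of a "a + b"] by simp
  finally show ?thesis by (simp add: power2_eq_square)
qed

text \<open>The case \<open>r = 1\<close> identifies the two generating functions, and powers are trivial on the side
  of the closed form.\<close>

theorem shuffle_conv_eq: "real (shuffle_conv r a b) = legendre_coeff r a b"
proof -
  have "shuffle_fps q = legendre_fps 1 q" for q
    by (rule fps_ext) (simp add: legendre_fps_nth' legendre_coeff_1[unfolded One_nat_def] shuffle_fps_def)
  then have "(\<Sum>i\<le>a+b. real (shuffle_conv r i (a + b - i)) * q ^ i) = (\<Sum>i\<le>a+b. legendre_coeff r i (a + b - i) * q ^ i)" for q
    using shuffle_fps_power_nth[of q r "a + b"] legendre_fps_power[of q r] legendre_fps_nth'[of r q "a + b"] by simp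
  \<comment> \<open>Both sides are polynomials in \<open>q\<close> that agree for all real \<open>q\<close>.\<close>
  then have "\<forall>i\<le>a+b. real (shuffle_conv r i (a + b - i)) = legendre_coeff r i (a + b - i)"
    by (subst polyfun_eq_coeffs[symmetric]) blast
  from this[rule_format, of a] show ?thesis by simp
qed

section \<open>The second moment\<close>

abbreviation gap_size :: "(nat \<times> nat) list \<Rightarrow> nat" where
  "gap_size g \<equiv> gap_total1 g + sum_list (map snd g)"

text \<open>The number of ways to arrange the letters inside the gaps.\<close>

definition gap_weight :: "(nat \<times> nat) list \<Rightarrow> nat" where
  "gap_weight g = prod_list (map (\<lambda>(a, b). (a + b) choose a) g)"

lemma finite_words [simp]: "finite {w :: (bool \<times> bool) list. length w = n \<and> P w}"
  by (rule finite_subset[OF _ finite_lists_length_eq[of UNIV n]]) auto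

text \<open>Removing the first letter leaves the pattern alone, shortens the first gap, or removes an
  empty first gap.\<close>

lemma words_gap_pattern_Suc:
  "{w. length w = Suc n \<and> gap_pattern w = (a, b) # gs} =
     Cons (False, False) ` {w. length w = n \<and> gap_pattern w = (a, b) # gs}
   \<union> Cons (True, True) ` {w. length w = n \<and> a = 0 \<and> b = 0 \<and> gap_pattern w = gs}
   \<union> (Cons (True, False) ` {w. length w = n \<and> 0 < a \<and> gap_pattern w = (a - 1, b) # gs}
   \<union> Cons (False, True) ` {w. length w = n \<and> 0 < b \<and> gap_pattern w = (a, b - 1) # gs})" (is "?L = ?R")
proof (intro equalityI subsetI)
  fix w assume "w \<in> ?L"
  then obtain p q w' where w: "w = (p, q) # w'" "length w' = n" "gap_pattern w = (a, b) # gs"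
    by (cases w) auto
  obtain a' b' gs' where g: "gap_pattern w' = (a', b') # gs'" by (cases "gap_pattern w'") auto
  show "w \<in> ?R"
    using w g by (cases p; cases q) (auto simp: image_iff)
next
  fix w assume "w \<in> ?R"
  then show "w \<in> ?L" by auto
qed

text \<open>The positions of the \<open>gap_size g\<close> letters other than \<open>(False, False)\<close> are arbitrary, and so is
  the order of the letters inside each gap. In the induction both factors follow Pascal's rule.\<close>

lemma card_words_gap_pattern:
  "g \<noteq> [] \<Longrightarrow> card {w. length w = n \<and> gap_pattern w = g} = (n choose gap_size g) * gap_weight g"
proof (induction n arbitrary: g)
  case 0
  obtain a b gs where g: "g = (a, b) # gs" using 0 by (cases g) auto
  have set_eq: "{w. length w = 0 \<and> gap_pattern w = g} = (if g = [(0, 0)] then {[]} else {})"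
    by auto
  have size_eq: "gap_size g = 0 \<longleftrightarrow> g = [(0, 0)]"
    by (auto simp: g)
  show ?case
  proof (cases "g = [(0, 0)]")
    case True
    then show ?thesis unfolding set_eq if_P[OF True] by (simp add: gap_weight_def)
  next
    case False
    then obtain m where "gap_size g = Suc m" using size_eq by (cases "gap_size g") blast+
    then show ?thesis
      unfolding set_eq if_not_P[OF False] by (simp only: card.empty binomial_0_Suc mult_0)
  qed
next
  case (Suc n)
  obtain a b gs where g: "g = (a, b) # gs" using Suc.prems by (cases g) auto
  let ?W = "\<lambda>P. {w. length w = n \<and> P w}"
  have "card {w. length w = Suc n \<and> gap_pattern w = g} =
      card (?W (\<lambda>w. gap_pattern w = (a, b) # gs)) + card (?W (\<lambda>w. a = 0 \<and> b = 0 \<and> gap_pattern w = gs))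
    + (card (?W (\<lambda>w. 0 < a \<and> gap_pattern w = (a - 1, b) # gs))
    + card (?W (\<lambda>w. 0 < b \<and> gap_pattern w = (a, b - 1) # gs)))"
    unfolding g words_gap_pattern_Suc
    by (subst card_Un_disjoint; auto simp: card_image)+
  also have "\<dots> = (Suc n choose gap_size g) * gap_weight g"
  proof (cases "a = 0 \<and> b = 0")
    case True
    then show ?thesis
      by (cases gs) (simp_all add: g Suc.IH gap_weight_def distrib_right)
  next
    case False
    then obtain m where m: "gap_size g = Suc m" by (cases "gap_size g") (auto simp: g)
    have "card (?W (\<lambda>w. 0 < a \<and> gap_pattern w = (a - 1, b) # gs)) =
        (n choose m) * (if 0 < a then (a - 1 + b) choose (a - 1) else 0) * gap_weight gs"
      using m by (cases a) (simp_all add: g Suc.IH gap_weight_def)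
    moreover have "card (?W (\<lambda>w. 0 < b \<and> gap_pattern w = (a, b - 1) # gs)) =
        (n choose m) * (if 0 < b then (a + (b - 1)) choose a else 0) * gap_weight gs"
      using m by (cases b) (simp_all add: g Suc.IH gap_weight_def)
    moreover have "card (?W (\<lambda>w. gap_pattern w = (a, b) # gs)) = (n choose Suc m) * ((a + b) choose a) * gap_weight gs"
      using m by (simp add: g Suc.IH gap_weight_def)
    moreover have "?W (\<lambda>w. a = 0 \<and> b = 0 \<and> gap_pattern w = gs) = {}" using False by auto
    moreover have "(a + b) choose a = (if 0 < a then (a - 1 + b) choose (a - 1) else 0) + (if 0 < b then (a + (b - 1)) choose a else 0)"
      using False by (cases a; cases b) auto
    moreover have "gap_weight g = ((a + b) choose a) * gap_weight gs"
      by (simp add: g gap_weight_def)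
    ultimately show ?thesis
      using m by (simp add: algebra_simps)
  qed
  finally show ?case .
qed

definition gap_lists :: "nat \<Rightarrow> nat \<Rightarrow> nat \<Rightarrow> (nat \<times> nat) list set" where
  "gap_lists r a b = {g. length g = r \<and> sum_list (map fst g) = a \<and> sum_list (map snd g) = b}"

lemma gap_lists_0: "gap_lists 0 a b = (if a = 0 \<and> b = 0 then {[]} else {})"
  by (auto simp: gap_lists_def)

lemma bij_betw_gap_lists_Suc:
  "bij_betw (\<lambda>((a', b'), g). (a', b') # g) (SIGMA p:{..a} \<times> {..b}. gap_lists r (a - fst p) (b - snd p)) (gap_lists (Suc r) a b)"
  by (rule bij_betw_byWitness[where f' = "\<lambda>g. (hd g, tl g)"])
     (auto simp: gap_lists_def length_Suc_conv)

lemma finite_gap_lists [simp]: "finite (gap_lists r a b)"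
proof (induction r arbitrary: a b)
  case (Suc r)
  show ?case
    using bij_betw_finite[OF bij_betw_gap_lists_Suc[of a b r]] Suc by auto
qed (simp add: gap_lists_0)

lemma sum_gap_weight_squared: "(\<Sum>g\<in>gap_lists r a b. (gap_weight g)\<^sup>2) = shuffle_conv r a b"
proof (induction r arbitrary: a b)
  case (Suc r)
  have "(\<Sum>g\<in>gap_lists (Suc r) a b. (gap_weight g)\<^sup>2) =
     (\<Sum>((a', b'), g)\<in>(SIGMA p:{..a} \<times> {..b}. gap_lists r (a - fst p) (b - snd p)). ((a' + b') choose a')\<^sup>2 * (gap_weight g)\<^sup>2)"
    by (subst sum.reindex_bij_betw[OF bij_betw_gap_lists_Suc, symmetric])
       (auto intro!: sum.cong simp: gap_weight_def power_mult_distrib)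
  also have "\<dots> = (\<Sum>(a', b')\<in>{..a} \<times> {..b}. ((a' + b') choose a')\<^sup>2 * shuffle_conv r (a - a') (b - b'))"
    by (subst sum.Sigma[symmetric]) (auto intro!: sum.cong simp: Suc.IH[symmetric] sum_distrib_left)
  finally show ?case
    by (simp add: sum.cartesian_product)
qed (simp add: gap_lists_0 gap_weight_def)

definition gap_patterns :: "nat \<Rightarrow> (nat \<times> nat) list set" where
  "gap_patterns k = {g. g \<noteq> [] \<and> gap_total1 g = k \<and> gap_total2 g = k}"

lemma gap_patterns_eq: "gap_patterns k = (\<Union>t\<le>k. gap_lists (Suc t) (k - t) (k - t))"
proof (intro equalityI subsetI)
  fix g assume g: "g \<in> gap_patterns k"
  then obtain t where "length g = Suc t" by (cases g) (auto simp: gap_patterns_def)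
  with g show "g \<in> (\<Union>t\<le>k. gap_lists (Suc t) (k - t) (k - t))"
    by (auto simp: gap_patterns_def gap_lists_def intro!: bexI[of _ t])
qed (auto simp: gap_patterns_def gap_lists_def)

lemma card_positions_gap:
  "card (set (true_positions i (map fst w)) \<union> set (true_positions i (map snd w))) = gap_size (gap_pattern w)"
proof (induction w arbitrary: i rule: gap_pattern.induct)
  case (2 w)
  obtain a b gs where g: "gap_pattern w = (a, b) # gs" by (cases "gap_pattern w") auto
  show ?case using 2[of "Suc i"] by (simp add: g card_insert_if) (simp add: set_true_positions)
next
  case (4 w)
  obtain a b gs where g: "gap_pattern w = (a, b) # gs" by (cases "gap_pattern w") auto
  show ?case using 4[of "Suc i"] by (simp add: g card_insert_if) (simp add: set_true_positions)
next
  case (5 w)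
  obtain a b gs where g: "gap_pattern w = (a, b) # gs" by (cases "gap_pattern w") auto
  show ?case using 5[of "Suc i"] by (simp add: g card_insert_if) (simp add: set_true_positions)
next
  case (3 w)
  show ?case using 3[of "Suc i"] by simp
qed simp

text \<open>Concatenating the two tuples turns the two conditions into a single prescription of values.
  Since tuples have distinct entries, its equality pattern is given by the coincidences, hence
  by the gap pattern.\<close>

lemma card_permutes_two_tuples:
  assumes w: "w \<in> pair_words n k" and w': "w' \<in> pair_words n k"
  shows "card {\<pi>. \<pi> permutes {1..n} \<and> map \<pi> (fst (word_pair w)) = fst (word_pair w') \<and> map \<pi> (snd (word_pair w)) = snd (word_pair w')}
    = (if gap_pattern w = gap_pattern w' then fact (n - gap_size (gap_pattern w)) else 0)"
proof -
  define u1 u2 v1 v2 where defs: "u1 = fst (word_pair w)" "u2 = snd (word_pair w)" "v1 = fst (word_pair w')" "v2 = snd (word_pair w')"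
  have u: "u1 \<in> index_tuples n k" "u2 \<in> index_tuples n k" "v1 \<in> index_tuples n k" "v2 \<in> index_tuples n k"
    using bij_betwE[OF bij_betw_word_pair[of n k]] w w' by (auto simp: defs mem_Times_iff)
  then have len: "length u1 = k" "length u2 = k" "length v1 = k" "length v2 = k"
    and dist: "distinct u1" "distinct u2" "distinct v1" "distinct v2"
    and sub: "set u1 \<subseteq> {1..n}" "set u2 \<subseteq> {1..n}" "set v1 \<subseteq> {1..n}" "set v2 \<subseteq> {1..n}"
    by (auto simp: index_tuples_def strict_sorted_iff)
  have "{\<pi>. \<pi> permutes {1..n} \<and> map \<pi> u1 = v1 \<and> map \<pi> u2 = v2} = {\<pi>. \<pi> permutes {1..n} \<and> map \<pi> (u1 @ u2) = v1 @ v2}"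
    using len by auto
  moreover have "card {\<pi>. \<pi> permutes {1..n} \<and> map \<pi> (u1 @ u2) = v1 @ v2} =
      (if \<forall>i<length (u1 @ u2). \<forall>j<length (u1 @ u2). (u1 @ u2) ! i = (u1 @ u2) ! j \<longleftrightarrow> (v1 @ v2) ! i = (v1 @ v2) ! j
       then fact (card {1..n} - card (set (u1 @ u2))) else 0)"
    using len sub by (intro card_permutes_map_eq) auto
  moreover have "(\<forall>i<length (u1 @ u2). \<forall>j<length (u1 @ u2). (u1 @ u2) ! i = (u1 @ u2) ! j \<longleftrightarrow> (v1 @ v2) ! i = (v1 @ v2) ! j)
      \<longleftrightarrow> coincidences u1 u2 = coincidences v1 v2" (is "?L \<longleftrightarrow> ?R")
  proof
    assume L: ?L
    have "u1 ! i = u2 ! j \<longleftrightarrow> v1 ! i = v2 ! j" if "i < k" "j < k" for i j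
      using L[rule_format, of i "k + j"] that len by (auto simp: nth_append)
    then show ?R using len by (auto simp: coincidences_def)
  next
    assume ?R
    then have R: "u1 ! i = u2 ! j \<longleftrightarrow> v1 ! i = v2 ! j" if "i < k" "j < k" for i j
      using that len by (auto simp: coincidences_def set_eq_iff)
    have "(u1 @ u2) ! i = (u1 @ u2) ! j \<longleftrightarrow> (v1 @ v2) ! i = (v1 @ v2) ! j" if "i < k + k" "j < k + k" for i j
      using R[of i "j - k"] R[of j "i - k"] that len dist
      by (auto simp: nth_append nth_eq_iff_index_eq)
    then show ?L using len by auto
  qed
  moreover have "coincidences u1 u2 = coincidences v1 v2 \<longleftrightarrow> gap_pattern w = gap_pattern w'"
  proof
    assume "coincidences u1 u2 = coincidences v1 v2"
    then show "gap_pattern w = gap_pattern w'"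
      using len length_true_positions_gap[of 1 w] length_true_positions_gap[of 1 w']
      by (intro gap_coincidences_inject) (simp_all add: defs word_pair_def coincidences_true_positions)
  qed (simp add: defs word_pair_def coincidences_true_positions)
  moreover have "card (set (u1 @ u2)) = gap_size (gap_pattern w)"
    using card_positions_gap[of 1 w] by (simp add: defs word_pair_def)
  ultimately show ?thesis
    unfolding defs[symmetric] by simp
qed

text \<open>Pairs of index tuples and pairs of image tuples are grouped by their common gap pattern, which
  is why the number of words with a given pattern enters squared.\<close>

lemma sum_Z_squared:
  "(\<Sum>\<pi>\<in>{\<pi>. \<pi> permutes {1..n}}. (Z n k \<pi>)\<^sup>2) =
    (\<Sum>g\<in>gap_patterns k. (real ((n choose gap_size g) * gap_weight g))\<^sup>2 * fact (n - gap_size g))"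
proof -
  let ?P = "{\<pi>. \<pi> permutes {1..n}}" and ?I = "index_tuples n k" and ?W = "pair_words n k"
  let ?m = "\<lambda>\<pi> p p'. map \<pi> (fst p) = fst p' \<and> map \<pi> (snd p) = snd p'"
  have finW: "finite ?W" unfolding pair_words_def by simp
  have finG: "finite (gap_patterns k)" by (simp add: gap_patterns_eq)
  have "(\<Sum>\<pi>\<in>?P. (Z n k \<pi>)\<^sup>2) = (\<Sum>\<pi>\<in>?P. \<Sum>p\<in>?I \<times> ?I. \<Sum>p'\<in>?I \<times> ?I. of_bool (?m \<pi> p p'))"
  proof (intro sum.cong refl)
    fix \<pi> assume \<pi>: "\<pi> \<in> ?P"
    have "(Z n k \<pi>)\<^sup>2 = (\<Sum>(is, js)\<in>?I \<times> ?I. of_bool (sorted_wrt (<) (map \<pi> is)) * of_bool (sorted_wrt (<) (map \<pi> js)))"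
      unfolding Z_def power2_eq_square sum_product sum.cartesian_product ..
    also have "\<dots> = (\<Sum>(is, js)\<in>?I \<times> ?I. (\<Sum>is'\<in>?I. of_bool (map \<pi> is = is')) * (\<Sum>js'\<in>?I. of_bool (map \<pi> js = js')))"
      using \<pi> by (intro sum.cong refl) (auto simp: sum_permutes_sorted)
    also have "\<dots> = (\<Sum>p\<in>?I \<times> ?I. \<Sum>p'\<in>?I \<times> ?I. of_bool (?m \<pi> p p'))"
    proof (rule sum.cong[OF refl])
      show "(case p of (is, js) \<Rightarrow> (\<Sum>is'\<in>?I. of_bool (map \<pi> is = is')) * (\<Sum>js'\<in>?I. of_bool (map \<pi> js = js')))
        = (\<Sum>p'\<in>?I \<times> ?I. of_bool (?m \<pi> p p') :: real)" for p
        unfolding case_prod_unfold sum_product sum.cartesian_product of_bool_conj[symmetric] ..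
    qed
    finally show "(Z n k \<pi>)\<^sup>2 = (\<Sum>p\<in>?I \<times> ?I. \<Sum>p'\<in>?I \<times> ?I. of_bool (?m \<pi> p p'))" .
  qed
  also have "\<dots> = (\<Sum>p\<in>?I \<times> ?I. \<Sum>p'\<in>?I \<times> ?I. \<Sum>\<pi>\<in>?P. of_bool (?m \<pi> p p'))"
    by (subst sum.swap, intro sum.cong refl, subst sum.swap, rule refl)
  also have "\<dots> = (\<Sum>p\<in>?I \<times> ?I. \<Sum>p'\<in>?I \<times> ?I. real (card {\<pi>. \<pi> permutes {1..n} \<and> ?m \<pi> p p'}))"
    by (intro sum.cong refl) (simp add: finite_permutations Int_def)
  also have "\<dots> = (\<Sum>w\<in>?W. \<Sum>w'\<in>?W. real (card {\<pi>. \<pi> permutes {1..n} \<and> ?m \<pi> (word_pair w) (word_pair w')}))"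
    unfolding sum.reindex_bij_betw[OF bij_betw_word_pair, symmetric] ..
  also have "\<dots> = (\<Sum>w\<in>?W. \<Sum>w'\<in>?W. if gap_pattern w' = gap_pattern w then fact (n - gap_size (gap_pattern w)) else 0)"
  proof (intro sum.cong refl)
    fix w w' assume "w \<in> ?W" "w' \<in> ?W"
    then show "real (card {\<pi>. \<pi> permutes {1..n} \<and> ?m \<pi> (word_pair w) (word_pair w')}) =
        (if gap_pattern w' = gap_pattern w then fact (n - gap_size (gap_pattern w)) else 0)"
      by (subst card_permutes_two_tuples) auto
  qed
  also have "\<dots> = (\<Sum>w\<in>?W. real (card {w'\<in>?W. gap_pattern w' = gap_pattern w}) * fact (n - gap_size (gap_pattern w)))"
    using finW by (intro sum.cong refl) (simp add: sum.If_cases Int_def)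
  also have "\<dots> = (\<Sum>g\<in>gap_patterns k. \<Sum>w\<in>{w\<in>?W. gap_pattern w = g}. real (card {w'\<in>?W. gap_pattern w' = gap_pattern w}) * fact (n - gap_size (gap_pattern w)))"
    using length_true_positions_gap[of 1]
    by (intro sum.group[symmetric] finW finG) (auto simp: gap_patterns_def pair_words_def word_pair_def)
  also have "\<dots> = (\<Sum>g\<in>gap_patterns k. (real ((n choose gap_size g) * gap_weight g))\<^sup>2 * fact (n - gap_size g))"
  proof (intro sum.cong refl)
    fix g assume g: "g \<in> gap_patterns k"
    then have "{w\<in>?W. gap_pattern w = g} = {w. length w = n \<and> gap_pattern w = g}"
      using length_true_positions_gap[of 1] by (auto simp: gap_patterns_def pair_words_def word_pair_def)
    then have "card {w\<in>?W. gap_pattern w = g} = (n choose gap_size g) * gap_weight g"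
      using g card_words_gap_pattern[of g n] by (simp add: gap_patterns_def)
    then show "(\<Sum>w\<in>{w\<in>?W. gap_pattern w = g}. real (card {w'\<in>?W. gap_pattern w' = gap_pattern w}) * fact (n - gap_size (gap_pattern w)))
      = (real ((n choose gap_size g) * gap_weight g))\<^sup>2 * fact (n - gap_size g)"
      by (simp add: power2_eq_square)
  qed
  finally show ?thesis .
qed

text \<open>With \<open>t\<close> common elements the pattern has \<open>t + 1\<close> gaps, both kinds of letters occur \<open>k - t\<close> times,
  and the union has \<open>2 k - t\<close> elements.\<close>

lemma second_moment_Z_shuffle:
  "measure_pmf.expectation (uniform_permutation n) (\<lambda>\<pi>. (Z n k \<pi>)\<^sup>2) =
    (\<Sum>t\<le>k. real (n choose (2 * k - t)) / fact (2 * k - t) * real (shuffle_conv (Suc t) (k - t) (k - t)))"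
proof -
  have "(\<Sum>\<pi>\<in>{\<pi>. \<pi> permutes {1..n}}. (Z n k \<pi>)\<^sup>2) =
     (\<Sum>t\<le>k. \<Sum>g\<in>gap_lists (Suc t) (k - t) (k - t). (real ((n choose gap_size g) * gap_weight g))\<^sup>2 * fact (n - gap_size g))"
    unfolding sum_Z_squared gap_patterns_eq
    by (rule sum.UNION_disjoint) (simp_all, auto simp: gap_lists_def)
  also have "\<dots> = (\<Sum>t\<le>k. \<Sum>g\<in>gap_lists (Suc t) (k - t) (k - t). real (n choose (2 * k - t))^2 * fact (n - (2 * k - t)) * real ((gap_weight g)\<^sup>2))"
  proof (intro sum.cong refl)
    fix t g assume "t \<in> {..k}" "g \<in> gap_lists (Suc t) (k - t) (k - t)"
    then have "gap_size g = 2 * k - t" by (auto simp: gap_lists_def)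
    then show "(real ((n choose gap_size g) * gap_weight g))\<^sup>2 * fact (n - gap_size g) =
      real (n choose (2 * k - t))^2 * fact (n - (2 * k - t)) * real ((gap_weight g)\<^sup>2)"
      by (simp add: power_mult_distrib)
  qed
  also have "\<dots> = (\<Sum>t\<le>k. real (n choose (2 * k - t))^2 * fact (n - (2 * k - t)) * real (shuffle_conv (Suc t) (k - t) (k - t)))"
    by (simp only: sum_distrib_left[symmetric] of_nat_sum[symmetric] sum_gap_weight_squared)
  finally have "measure_pmf.expectation (uniform_permutation n) (\<lambda>\<pi>. (Z n k \<pi>)\<^sup>2) =
    (\<Sum>t\<le>k. real (n choose (2 * k - t))^2 * fact (n - (2 * k - t)) / fact n * real (shuffle_conv (Suc t) (k - t) (k - t)))"
    by (simp only: expectation_uniform_permutation sum_divide_distrib times_divide_eq_left)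
  also have "\<dots> = (\<Sum>t\<le>k. real (n choose (2 * k - t)) / fact (2 * k - t) * real (shuffle_conv (Suc t) (k - t) (k - t)))"
  proof (intro sum.cong refl arg_cong2[where f = "(*)"])
    fix t
    show "real (n choose (2 * k - t))^2 * fact (n - (2 * k - t)) / fact n = real (n choose (2 * k - t)) / fact (2 * k - t)"
      by (cases "2 * k - t \<le> n") (simp_all add: binomial_fact power2_eq_square binomial_eq_0)
  qed
  finally show ?thesis .
qed

theorem second_moment_Z:
  "measure_pmf.expectation (uniform_permutation n) (\<lambda>\<pi>. (Z n k \<pi>)\<^sup>2) = second_moment_formula n k"
proof -
  have "second_moment_formula n k = (\<Sum>(t, s)\<in>(SIGMA t:{..k}. {..k - t}). 
        4 ^ (k - t) / fact (2 * k - t) * real (n choose (2 * k - t))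
        * ((real k - real t - real s - 1 / 2) gchoose (k - t - s))
        * ((real s + (real t + 1) / 2 - 1) gchoose s)
        * real ((2 * k - t) choose (2 * k - 2 * t - 2 * s)))"
    unfolding second_moment_formula_def by (rule sum.cong) auto
  also have "\<dots> = (\<Sum>t\<le>k. \<Sum>s\<le>k-t.
        4 ^ (k - t) / fact (2 * k - t) * real (n choose (2 * k - t))
        * ((real k - real t - real s - 1 / 2) gchoose (k - t - s))
        * ((real s + (real t + 1) / 2 - 1) gchoose s)
        * real ((2 * k - t) choose (2 * k - 2 * t - 2 * s)))"
    by (subst sum.Sigma) auto
  also have "\<dots> = (\<Sum>t\<le>k. real (n choose (2 * k - t)) / fact (2 * k - t) * legendre_coeff (Suc t) (k - t) (k - t))"
    unfolding legendre_coeff_def sum_distrib_left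
  proof (intro sum.cong)
    fix t s assume "t \<in> {..k}" and "s \<in> {..min (k - t) (k - t)}"
    then have ts: "t \<le> k" "s \<le> k - t" by auto
    \<comment> \<open>The factor with upper argument \<open>m - 1 / 2\<close> is a central binomial coefficient.\<close>
    define m where "m = k - t - s"
    have m: "k = m + t + s" using ts by (simp add: m_def)
    have "4 ^ (m + s) * ((real m - 1 / 2) gchoose m) = 4 ^ s * real ((2 * m) choose m)"
      using gchoose_half[of m] by (simp add: power_add mult_ac)
    then have *: "X * (4 ^ (m + s) * ((real m - 1 / 2) gchoose m)) = X * (4 ^ s * real ((2 * m) choose m))" for X
      by simp
    have "4 ^ (k - t) / fact (2 * k - t) * real (n choose (2 * k - t))
        * ((real k - real t - real s - 1 / 2) gchoose (k - t - s))
        * ((real s + (real t + 1) / 2 - 1) gchoose s)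
        * real ((2 * k - t) choose (2 * k - 2 * t - 2 * s))
      = (real (n choose (2 * k - t)) / fact (2 * k - t) * ((real s + (real t + 1) / 2 - 1) gchoose s) *
         real ((2 * k - t) choose (2 * m))) * (4 ^ (m + s) * ((real m - 1 / 2) gchoose m))"
      by (simp add: m mult_ac)
    also have "\<dots> = real (n choose (2 * k - t)) / fact (2 * k - t) *
       (((real s + real (Suc t) / 2 - 1) gchoose s) * 4 ^ s * real ((k - t + (k - t) - 2 * s) choose (k - t - s)) *
        real ((k - t + (k - t) + Suc t - 1) choose (k - t + (k - t) - 2 * s)))"
    proof -
      have "k - t + (k - t) - 2 * s = 2 * m" "k - t - s = m" "k - t + (k - t) + Suc t - 1 = 2 * k - t" "real (Suc t) = real t + 1"
        by (auto simp: m)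
      then show ?thesis unfolding * by (simp only: mult_ac)
    qed
    finally show "4 ^ (k - t) / fact (2 * k - t) * real (n choose (2 * k - t))
        * ((real k - real t - real s - 1 / 2) gchoose (k - t - s))
        * ((real s + (real t + 1) / 2 - 1) gchoose s)
        * real ((2 * k - t) choose (2 * k - 2 * t - 2 * s)) = 
       real (n choose (2 * k - t)) / fact (2 * k - t) *
       (((real s + real (Suc t) / 2 - 1) gchoose s) * 4 ^ s * real ((k - t + (k - t) - 2 * s) choose (k - t - s)) *
        real ((k - t + (k - t) + Suc t - 1) choose (k - t + (k - t) - 2 * s)))" .
  qed auto
  also have "\<dots> = measure_pmf.expectation (uniform_permutation n) (\<lambda>\<pi>. (Z n k \<pi>)\<^sup>2)"
    by (simp only: second_moment_Z_shuffle shuffle_conv_eq)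
  finally show ?thesis ..
qed

section \<open>Weak limits and distance in mean square\<close>

text \<open>At every point, characteristic functions are Lipschitz in the random variable with respect to
  the mean distance, hence also with respect to the mean square distance; Levy's continuity
  theorem does the rest.\<close>

lemma (in prob_space) weak_conv_m_L2_close:
  fixes X Y :: "nat \<Rightarrow> 'a \<Rightarrow> real"
  assumes X[measurable]: "\<And>n. random_variable borel (X n)"
    and Y[measurable]: "\<And>n. random_variable borel (Y n)"
    and sq: "\<And>n. integrable M (\<lambda>x. (X n x - Y n x)\<^sup>2)"
    and lim: "(\<lambda>n. expectation (\<lambda>x. (X n x - Y n x)\<^sup>2)) \<longlonglongrightarrow> 0"
    and N: "real_distribution N" and conv: "weak_conv_m (\<lambda>n. distr M borel (Y n)) N"
  shows "weak_conv_m (\<lambda>n. distr M borel (X n)) N"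
proof (rule levy_continuity)
  fix t :: real
  have char_eq: "char (distr M borel Z) t = expectation (\<lambda>x. iexp (t * Z x))" if [measurable]: "random_variable borel Z" for Z
    by (simp add: char_def integral_distr)
  have int: "integrable M (\<lambda>x. iexp (t * Z x))" if [measurable]: "random_variable borel Z" for Z
    by (rule integrable_const_bound[of _ 1]) auto
  have int_diff: "integrable M (\<lambda>x. X n x - Y n x)" for n
    by (rule square_integrable_imp_integrable[OF _ sq]) simp
  have L1_L2: "expectation (\<lambda>x. \<bar>X n x - Y n x\<bar>) \<le> sqrt (expectation (\<lambda>x. (X n x - Y n x)\<^sup>2))" for n
  proof (rule real_le_rsqrt)
    have "variance (\<lambda>x. \<bar>X n x - Y n x\<bar>) = expectation (\<lambda>x. (X n x - Y n x)\<^sup>2) - (expectation (\<lambda>x. \<bar>X n x - Y n x\<bar>))\<^sup>2"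
      using int_diff sq by (subst variance_eq) (simp_all add: integrable_abs)
    with variance_positive[of "\<lambda>x. \<bar>X n x - Y n x\<bar>"]
    show "(expectation (\<lambda>x. \<bar>X n x - Y n x\<bar>))\<^sup>2 \<le> expectation (\<lambda>x. (X n x - Y n x)\<^sup>2)" by simp
  qed
  have iexp_diff: "cmod (iexp a - iexp b) \<le> \<bar>a - b\<bar>" for a b :: real
  proof -
    have "iexp a - iexp b = iexp b * (iexp (a - b) - 1)"
      by (simp add: algebra_simps flip: exp_add)
    then have "cmod (iexp a - iexp b) = cmod (iexp (a - b) - 1)"
      by (simp add: norm_mult)
    also have "\<dots> \<le> \<bar>a - b\<bar>" using iexp_approx1[of "a - b" 0] by simp
    finally show ?thesis .
  qed
  have bound: "cmod (char (distr M borel (X n)) t - char (distr M borel (Y n)) t)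
     \<le> \<bar>t\<bar> * sqrt (expectation (\<lambda>x. (X n x - Y n x)\<^sup>2))" for n
  proof -
    have "cmod (char (distr M borel (X n)) t - char (distr M borel (Y n)) t)
      = cmod (expectation (\<lambda>x. iexp (t * X n x) - iexp (t * Y n x)))"
      unfolding char_eq[OF X] char_eq[OF Y] Bochner_Integration.integral_diff[OF int[OF X] int[OF Y]] ..
    also have "\<dots> \<le> expectation (\<lambda>x. cmod (iexp (t * X n x) - iexp (t * Y n x)))"
      by (rule integral_norm_bound)
    also have "\<dots> \<le> expectation (\<lambda>x. \<bar>t\<bar> * \<bar>X n x - Y n x\<bar>)"
    proof (rule integral_mono)
      show "integrable M (\<lambda>x. cmod (iexp (t * X n x) - iexp (t * Y n x)))"
        by (intro integrable_norm Bochner_Integration.integrable_diff int X Y)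
      show "integrable M (\<lambda>x. \<bar>t\<bar> * \<bar>X n x - Y n x\<bar>)"
        using int_diff by (intro integrable_mult_right integrable_abs)
      show "cmod (iexp (t * X n x) - iexp (t * Y n x)) \<le> \<bar>t\<bar> * \<bar>X n x - Y n x\<bar>" for x
        using iexp_diff[of "t * X n x" "t * Y n x"] by (simp add: abs_mult[symmetric] right_diff_distrib)
    qed
    also have "\<dots> \<le> \<bar>t\<bar> * sqrt (expectation (\<lambda>x. (X n x - Y n x)\<^sup>2))"
      using L1_L2[of n] by (simp add: mult_left_mono)
    finally show ?thesis .
  qed
  have "(\<lambda>n. \<bar>t\<bar> * sqrt (expectation (\<lambda>x. (X n x - Y n x)\<^sup>2))) \<longlonglongrightarrow> 0"
    using tendsto_mult[OF tendsto_const[of "\<bar>t\<bar>"] tendsto_real_sqrt[OF lim]] by simp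
  then have "(\<lambda>n. char (distr M borel (X n)) t - char (distr M borel (Y n)) t) \<longlonglongrightarrow> 0"
    by (rule Lim_null_comparison[OF always_eventually[OF allI[OF bound]]])
  moreover have "(\<lambda>n. char (distr M borel (Y n)) t) \<longlonglongrightarrow> char N t"
    by (rule levy_continuity1[OF _ N conv]) (simp add: real_distribution_distr)
  ultimately show "(\<lambda>n. char (distr M borel (X n)) t) \<longlonglongrightarrow> char N t"
    by (rule Lim_transform[rotated])
qed (simp_all add: real_distribution_distr N)

section \<open>Symmetric kernels and their projections\<close>

text \<open>A symmetric function of \<open>k\<close> sample points is encoded as a family \<open>h\<close> indexed by the set \<open>S\<close> of the
  indices that it looks at. Condition \<open>kernel_cong\<close> expresses both the symmetry (take \<open>S' = S\<close>)
  and that all members of the family are the same function up to renaming of the indices, and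
  with the identity for \<open>\<sigma>\<close> it says that \<open>h S\<close> depends on the sample only through the indices
  in \<open>S\<close>.\<close>

locale symmetric_kernel = prob_space D for D :: "'a measure" +
  fixes k :: nat and h :: "nat set \<Rightarrow> (nat \<Rightarrow> 'a) \<Rightarrow> real" and B :: real
  assumes k_pos: "1 \<le> k"
    and measurable_kernel: "\<And>S. finite S \<Longrightarrow> card S = k \<Longrightarrow> h S \<in> borel_measurable (PiM S (\<lambda>_. D))"
    and kernel_cong: "\<And>S S' \<sigma> x x'. finite S \<Longrightarrow> card S = k \<Longrightarrow> bij_betw \<sigma> S S' \<Longrightarrow>
           (\<And>i. i \<in> S \<Longrightarrow> x i = x' (\<sigma> i)) \<Longrightarrow> h S x = h S' x'"
    and kernel_bounded: "\<And>S x. \<bar>h S x\<bar> \<le> B"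
begin

abbreviation sample :: "nat set \<Rightarrow> (nat \<Rightarrow> 'a) measure" where
  "sample J \<equiv> PiM J (\<lambda>_. D)"

sublocale P: product_prob_space "\<lambda>_. D" "UNIV :: nat set"
  by standard

lemma prob_space_sample: "prob_space (sample J)"
  by (rule prob_space_PiM) (rule prob_space_axioms)

lemma integrable_sample_bounded:
  assumes "f \<in> borel_measurable (sample J)" "\<And>x. \<bar>f x\<bar> \<le> (c :: real)"
  shows "integrable (sample J) f"
proof -
  interpret S: prob_space "sample J" by (rule prob_space_sample)
  show ?thesis using assms by (intro S.integrable_const_bound[of _ c]) auto
qed

lemma measurable_sample_mono:
  assumes "f \<in> borel_measurable (sample J)" "J \<subseteq> L" "\<And>x. f (restrict x J) = f x"
  shows "(f :: _ \<Rightarrow> real) \<in> borel_measurable (sample L)"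
  using measurable_compose[OF measurable_restrict_subset[OF assms(2)] assms(1)] assms(3) by simp

text \<open>All random variables below live on infinite samples; this passes to the finitely many
  coordinates that matter, where Fubini's theorem is available.\<close>

lemma expectation_sample_restrict:
  assumes "f \<in> borel_measurable (sample J)" "finite J" "\<And>x. f (restrict x J) = (f x :: real)"
  shows "integral\<^sup>L (sample UNIV) f = integral\<^sup>L (sample J) f"
proof -
  have "integral\<^sup>L (sample J) f = integral\<^sup>L (distr (sample UNIV) (sample J) (\<lambda>x. restrict x J)) f"
    using P.distr_PiM_restrict_finite[OF assms(2)] by simp
  also have "\<dots> = integral\<^sup>L (sample UNIV) (\<lambda>x. f (restrict x J))"
    by (rule integral_distr[OF measurable_restrict_subset assms(1)]) simp
  finally show ?thesis using assms(3) by simp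
qed

lemma kernel_restrict:
  assumes "finite S" "card S = k" "S \<subseteq> J"
  shows "h S (restrict x J) = h S x"
  by (rule kernel_cong[of S id]) (use assms in auto)

lemma measurable_kernel' [measurable]:
  assumes "finite S" "card S = k" "S \<subseteq> J"
  shows "h S \<in> borel_measurable (sample J)"
  by (rule measurable_sample_mono[OF measurable_kernel]) (use assms kernel_restrict in auto)

lemma integrable_kernel:
  assumes "finite S" "card S = k" "S \<subseteq> J"
  shows "integrable (sample J) (h S)"
  by (rule integrable_sample_bounded[OF measurable_kernel' kernel_bounded]) (use assms in auto)

definition kernel_mean :: real where
  "kernel_mean = integral\<^sup>L (sample {..<k}) (h {..<k})"

text \<open>The conditional mean of the kernel given one of its arguments. By symmetry any set of \<open>k\<close>
  indices and any index in it could be used; the choice made here is removed in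
  \<open>projection_eq\<close>.\<close>

definition projection :: "'a \<Rightarrow> real" where
  "projection p = (\<integral>x. h {..<k} (x(0 := p)) \<partial>sample ({..<k} - {0}))"

lemma integral_kernel:
  assumes "finite S" "card S = k"
  shows "integral\<^sup>L (sample S) (h S) = kernel_mean"
proof -
  obtain f where f: "bij_betw f {..<k} S"
    using assms finite_same_card_bij[of "{..<k}" S] by auto
  have "kernel_mean = integral\<^sup>L (distr (sample S) (sample {..<k}) (\<lambda>x. \<lambda>n\<in>{..<k}. x (f n))) (h {..<k})"
    unfolding kernel_mean_def
    by (subst distr_PiM_reindex) (use f prob_space_axioms in \<open>auto simp: bij_betw_def\<close>)
  also have "\<dots> = integral\<^sup>L (sample S) (\<lambda>x. h {..<k} (\<lambda>n\<in>{..<k}. x (f n)))"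
    by (rule integral_distr) (use f in \<open>auto intro!: measurable_restrict measurable_component_singleton measurable_kernel simp: bij_betw_def\<close>)
  also have "\<dots> = integral\<^sup>L (sample S) (h S)"
    by (intro Bochner_Integration.integral_cong refl kernel_cong[of _ f]) (use f in auto)
  finally show ?thesis ..
qed

lemma measurable_kernel_update:
  assumes "finite S" "card S = k" "i \<in> S"
  shows "(\<lambda>(x, p). h S (x(i := p))) \<in> borel_measurable (sample (S - {i}) \<Otimes>\<^sub>M D)"
proof -
  have "insert i (S - {i}) = S" using assms by auto
  then show ?thesis
    using measurable_comp[OF measurable_add_dim[of i "S - {i}" "\<lambda>_. D"], of "h S" borel] measurable_kernel[OF assms(1,2)]
    by (simp add: comp_def case_prod_unfold)
qed

lemma measurable_kernel_update':
  assumes "finite S" "card S = k" "i \<in> S" "p \<in> space D"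
  shows "(\<lambda>x. h S (x(i := p))) \<in> borel_measurable (sample (S - {i}))"
  using measurable_compose[OF measurable_Pair2'[OF assms(4), of "sample (S - {i})"] measurable_kernel_update[OF assms(1-3)]]
  by simp

lemma projection_eq:
  assumes "finite S" "card S = k" "i \<in> S" "p \<in> space D"
  shows "(\<integral>x. h S (x(i := p)) \<partial>sample (S - {i})) = projection p"
proof -
  have "card ({..<k} - {0}) = card (S - {i})" using assms k_pos by simp
  then obtain f where f: "bij_betw f ({..<k} - {0}) (S - {i})"
    using finite_same_card_bij[of "{..<k} - {0}" "S - {i}"] assms(1) by auto
  define f' where "f' n = (if n = 0 then i else f n)" for n
  \<comment> \<open>Extend the renaming of the other indices by \<open>0 \<mapsto> i\<close>.\<close>
  have "bij_betw f' ({0} \<union> ({..<k} - {0})) ({i} \<union> (S - {i}))"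
  proof (rule bij_betw_combine)
    show "bij_betw f' ({..<k} - {0}) (S - {i})"
      using f by (rule bij_betw_cong[THEN iffD1, rotated]) (simp add: f'_def)
  qed (auto simp: f'_def)
  moreover have "{0} \<union> ({..<k} - {0}) = {..<k}" "{i} \<union> (S - {i}) = S" using k_pos assms by auto
  ultimately have f': "bij_betw f' {..<k} S" by simp
  have "projection p = (\<integral>x. h {..<k} (x(0 := p)) \<partial>distr (sample (S - {i})) (sample ({..<k} - {0})) (\<lambda>x. \<lambda>n\<in>{..<k} - {0}. x (f n)))"
    unfolding projection_def
    by (subst distr_PiM_reindex) (use f prob_space_axioms in \<open>auto simp: bij_betw_def\<close>)
  also have "\<dots> = (\<integral>x. h {..<k} ((\<lambda>n\<in>{..<k} - {0}. x (f n))(0 := p)) \<partial>sample (S - {i}))"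
  proof (rule integral_distr)
    show "(\<lambda>x. \<lambda>n\<in>{..<k} - {0}. x (f n)) \<in> sample (S - {i}) \<rightarrow>\<^sub>M sample ({..<k} - {0})"
      using f by (auto intro!: measurable_restrict measurable_component_singleton simp: bij_betw_def)
    show "(\<lambda>x. h {..<k} (x(0 := p))) \<in> borel_measurable (sample ({..<k} - {0}))"
      using k_pos assms(4) by (intro measurable_kernel_update') auto
  qed
  also have "\<dots> = (\<integral>x. h S (x(i := p)) \<partial>sample (S - {i}))"
    using f by (intro Bochner_Integration.integral_cong refl kernel_cong[OF _ _ f'])
      (auto simp: f'_def bij_betw_def)
  finally show ?thesis ..
qed

lemma measurable_projection [measurable]: "projection \<in> borel_measurable D"
proof -
  interpret S: prob_space "sample ({..<k} - {0})" by (rule prob_space_sample)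
  have "(\<lambda>(p, x). h {..<k} (x(0 := p))) \<in> borel_measurable (D \<Otimes>\<^sub>M sample ({..<k} - {0}))"
    using measurable_kernel_update[of "{..<k}" 0] k_pos
    by (subst measurable_pair_swap_iff) (simp add: case_prod_unfold)
  then show ?thesis
    unfolding projection_def[abs_def] by (rule S.borel_measurable_lebesgue_integral)
qed

text \<open>Outside the space of \<open>D\<close> the integrand need not be integrable, but then the integral is \<open>0\<close>.\<close>

lemma projection_bounded: "\<bar>projection p\<bar> \<le> B"
proof -
  interpret S: prob_space "sample ({..<k} - {0})" by (rule prob_space_sample)
  show ?thesis
  proof (cases "integrable (sample ({..<k} - {0})) (\<lambda>x. h {..<k} (x(0 := p)))")
    case True
    have "\<bar>projection p\<bar> \<le> (\<integral>x. \<bar>h {..<k} (x(0 := p))\<bar> \<partial>sample ({..<k} - {0}))"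
      unfolding projection_def by (rule integral_abs_bound)
    also have "\<dots> \<le> (\<integral>x. B \<partial>sample ({..<k} - {0}))"
      using True kernel_bounded by (intro integral_mono integrable_abs) auto
    finally show ?thesis by (simp add: S.prob_space)
  next
    case False
    then have "projection p = 0"
      unfolding projection_def by (rule not_integrable_integral_eq)
    then show ?thesis using kernel_bounded[of "{}" "\<lambda>_. undefined"] by simp
  qed
qed

lemma integrable_projection [simp]: "integrable D projection"
  by (rule integrable_const_bound[of _ B]) (use projection_bounded in auto)

lemma integral_projection: "integral\<^sup>L D projection = kernel_mean"
proof -
  interpret S: prob_space "sample ({..<k} - {0})" by (rule prob_space_sample)
  interpret pair_prob_space "sample ({..<k} - {0})" D ..
  have ins: "insert 0 ({..<k} - {0}) = {..<k}" using k_pos by auto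
  have int: "integrable (sample ({..<k} - {0}) \<Otimes>\<^sub>M D) (\<lambda>(x, p). h {..<k} (x(0 := p)))"
    using measurable_kernel_update[of "{..<k}" 0] k_pos kernel_bounded
    by (intro P.integrable_const_bound[of _ B]) auto
  have "kernel_mean = (\<integral>x. (\<integral>p. h {..<k} (x(0 := p)) \<partial>D) \<partial>sample ({..<k} - {0}))"
    using P.product_integral_insert[of "{..<k} - {0}" 0 "h {..<k}"] integrable_kernel[of "{..<k}" "{..<k}"]
    unfolding kernel_mean_def ins by simp
  also have "\<dots> = integral\<^sup>L D projection"
    using Fubini_integral[OF int] unfolding projection_def[abs_def] by simp
  finally show ?thesis ..
qed


section \<open>Orthogonality of the remainders\<close>

text \<open>The part of the centered kernel that is not explained by any single argument.\<close>

definition remainder :: "nat set \<Rightarrow> (nat \<Rightarrow> 'a) \<Rightarrow> real" where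
  "remainder S x = h S x - kernel_mean - (\<Sum>i\<in>S. projection (x i) - kernel_mean)"

lemma remainder_restrict:
  assumes "finite S" "card S = k" "S \<subseteq> J"
  shows "remainder S (restrict x J) = remainder S x"
  using assms by (auto simp: remainder_def kernel_restrict intro!: sum.cong)

lemma measurable_projection_component [measurable]:
  "i \<in> J \<Longrightarrow> (\<lambda>x. projection (x i)) \<in> borel_measurable (sample J)"
  by (intro measurable_compose[OF _ measurable_projection] measurable_component_singleton)

lemma measurable_remainder [measurable]:
  assumes "finite S" "card S = k" "S \<subseteq> J"
  shows "remainder S \<in> borel_measurable (sample J)"
  unfolding remainder_def[abs_def] using assms
  by (intro borel_measurable_diff borel_measurable_sum measurable_kernel' measurable_projection_component borel_measurable_const) auto

lemma kernel_mean_bounded: "\<bar>kernel_mean\<bar> \<le> B"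
proof -
  have "\<bar>kernel_mean\<bar> \<le> (\<integral>p. \<bar>projection p\<bar> \<partial>D)"
    unfolding integral_projection[symmetric] by (rule integral_abs_bound)
  also have "\<dots> \<le> (\<integral>p. B \<partial>D)"
    using projection_bounded by (intro integral_mono) auto
  finally show ?thesis by (simp add: prob_space)
qed

lemma bound_nonneg: "0 \<le> B"
  using kernel_mean_bounded by (rule order_trans[OF abs_ge_zero])

lemma centered_projection_bounded: "\<bar>projection p - kernel_mean\<bar> \<le> 2 * B"
  using projection_bounded[of p] kernel_mean_bounded by linarith

definition remainder_bound :: real where
  "remainder_bound = 2 * B + real k * (2 * B)"

lemma remainder_bounded:
  assumes "finite S" "card S = k"
  shows "\<bar>remainder S x\<bar> \<le> remainder_bound"
proof -
  have "\<bar>\<Sum>i\<in>S. projection (x i) - kernel_mean\<bar> \<le> (\<Sum>i\<in>S. 2 * B)"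
    by (intro order_trans[OF sum_abs] sum_mono centered_projection_bounded)
  then show ?thesis
    using kernel_bounded[of S x] kernel_mean_bounded assms unfolding remainder_def remainder_bound_def by simp
qed

lemma integral_projection_component:
  assumes "i \<in> J"
  shows "integrable (sample J) (\<lambda>x. projection (x i))"
    "(\<integral>x. projection (x i) \<partial>sample J) = kernel_mean"
proof -
  show "integrable (sample J) (\<lambda>x. projection (x i))"
    using assms projection_bounded by (intro integrable_sample_bounded[of _ _ B] measurable_projection_component) auto
  have "kernel_mean = (\<integral>p. projection p \<partial>distr (sample J) D (\<lambda>x. x i))"
    using assms by (subst distr_PiM_component) (auto simp: integral_projection prob_space_axioms)
  also have "\<dots> = (\<integral>x. projection (x i) \<partial>sample J)"
    using assms by (intro integral_distr) (auto intro: measurable_component_singleton)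
  finally show "(\<integral>x. projection (x i) \<partial>sample J) = kernel_mean" ..
qed

text \<open>Given the sample point with index \<open>i\<close>, the kernel has mean \<open>projection (y i)\<close>, the summand of
  \<open>i\<close> cancels it, and the other summands are centered.\<close>

lemma conditional_mean_remainder:
  assumes S: "finite S" "card S = k" "i \<in> S" and p: "y i \<in> space D" and J: "J \<inter> (S - {i}) = {}" "i \<in> J"
  shows "(\<integral>x. remainder S (merge (S - {i}) J (x, y)) \<partial>sample (S - {i})) = 0"
proof -
  let ?A = "S - {i}"
  interpret A: prob_space "sample ?A" by (rule prob_space_sample)
  have ins: "S = insert i ?A" using S by auto
  have eq: "remainder S (merge ?A J (x, y)) =
      h S (x(i := y i)) - kernel_mean - ((projection (y i) - kernel_mean) + (\<Sum>j\<in>?A. projection (x j) - kernel_mean))" for x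
  proof -
    have "h S (merge ?A J (x, y)) = h S (x(i := y i))"
      by (rule kernel_cong[of _ id]) (use S J in \<open>auto simp: merge_def\<close>)
    moreover have "(\<Sum>j\<in>S. projection (merge ?A J (x, y) j) - kernel_mean) =
      (projection (y i) - kernel_mean) + (\<Sum>j\<in>?A. projection (x j) - kernel_mean)"
      using S J by (subst sum.remove[of S i]) (auto simp: merge_def intro!: sum.cong)
    ultimately show ?thesis unfolding remainder_def by simp
  qed
  have int: "integrable (sample ?A) (\<lambda>x. h S (x(i := y i)))"
    by (rule integrable_sample_bounded[OF measurable_kernel_update'[OF S p] kernel_bounded])
  have int2: "integrable (sample ?A) (\<lambda>x. \<Sum>j\<in>?A. projection (x j) - kernel_mean)"
    by (intro Bochner_Integration.integrable_sum Bochner_Integration.integrable_diff integral_projection_component(1)) auto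
  have "(\<integral>x. (\<Sum>j\<in>?A. projection (x j) - kernel_mean) \<partial>sample ?A) = (\<Sum>j\<in>?A. (\<integral>x. projection (x j) - kernel_mean \<partial>sample ?A))"
    by (intro Bochner_Integration.integral_sum Bochner_Integration.integrable_diff integral_projection_component(1)) auto
  also have "\<dots> = 0"
    by (intro sum.neutral) (simp add: integral_projection_component A.prob_space)
  finally have "(\<integral>x. (\<Sum>j\<in>?A. projection (x j) - kernel_mean) \<partial>sample ?A) = 0" .
  then show ?thesis
    unfolding eq using int int2 projection_eq[OF S p] by (simp add: A.prob_space)
qed

text \<open>Integrate over the indices in \<open>S - {i}\<close> first. The factor \<open>F\<close> does not depend on them, and the
  conditional mean of the remainder vanishes.\<close>

lemma remainder_orthogonal:
  assumes S: "finite S" "card S = k" "i \<in> S" and J: "finite J" "J \<inter> (S - {i}) = {}" "i \<in> J"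
    and F: "F \<in> borel_measurable (sample J)" "\<And>x. F (restrict x J) = F x" "\<And>x. \<bar>F x\<bar> \<le> c"
  shows "(\<integral>x. remainder S x * F x \<partial>sample UNIV) = 0"
proof -
  let ?A = "S - {i}"
  have SJ: "S \<subseteq> ?A \<union> J" "J \<subseteq> ?A \<union> J" using S J by auto
  have meas: "(\<lambda>x. remainder S x * F x) \<in> borel_measurable (sample (?A \<union> J))"
    by (intro borel_measurable_times measurable_remainder[OF S(1,2) SJ(1)] measurable_sample_mono[OF F(1) SJ(2) F(2)])
  have bound: "\<bar>remainder S x * F x\<bar> \<le> remainder_bound * c" for x
    unfolding abs_mult using remainder_bounded[OF S(1,2)] F(3)[of x] by (intro mult_mono) (auto intro: order_trans[OF abs_ge_zero])
  have Frestrict: "F (restrict x (?A \<union> J)) = F x" for x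
  proof -
    have "restrict (restrict x (?A \<union> J)) J = restrict x J" by auto
    then show ?thesis using F(2) by metis
  qed
  have Fmerge: "F (merge ?A J (x, y)) = F y" for x y
  proof -
    have "restrict (merge ?A J (x, y)) J = restrict y J" using J by (auto simp: merge_def restrict_def fun_eq_iff)
    then show ?thesis using F(2) by metis
  qed
  have "(\<integral>x. remainder S x * F x \<partial>sample UNIV) = (\<integral>x. remainder S x * F x \<partial>sample (?A \<union> J))"
    by (rule expectation_sample_restrict[OF meas]) (use S J SJ in \<open>auto simp: remainder_restrict Frestrict\<close>)
  also have "\<dots> = (\<integral>x. (\<integral>y. remainder S (merge J ?A (x, y)) * F (merge J ?A (x, y)) \<partial>sample ?A) \<partial>sample J)"
    using P.product_integral_fold[of J ?A "\<lambda>x. remainder S x * F x"] integrable_sample_bounded[OF meas bound] J S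
    by (simp add: Un_commute)
  also have "\<dots> = (\<integral>y. (\<integral>x. remainder S (merge ?A J (x, y)) * F (merge ?A J (x, y)) \<partial>sample ?A) \<partial>sample J)"
  proof -
    have "merge J ?A (x, y) = merge ?A J (y, x)" for x y :: "nat \<Rightarrow> 'a"
      using J(2) by (rule merge_commute)
    then show ?thesis by (simp only:)
  qed
  also have "\<dots> = (\<integral>y. (\<integral>x. remainder S (merge ?A J (x, y)) \<partial>sample ?A) * F y \<partial>sample J)"
    unfolding Fmerge by simp
  also have "\<dots> = (\<integral>y. 0 \<partial>sample J)"
  proof (rule Bochner_Integration.integral_cong[OF refl])
    fix y assume "y \<in> space (sample J)"
    then have "y i \<in> space D" using J(3) by (auto simp: space_PiM)
    then show "(\<integral>x. remainder S (merge ?A J (x, y)) \<partial>sample ?A) * F y = 0"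
      using conditional_mean_remainder[OF S _ J(2,3)] by simp
  qed
  finally show ?thesis by simp
qed

text \<open>If the index sets share at most one index \<open>i\<close>, then the second remainder is a function of
  samples outside \<open>S - {i}\<close>. Disjoint sets are covered by an arbitrary \<open>i\<close> in \<open>S\<close>.\<close>

lemma remainders_orthogonal:
  assumes S: "finite S" "card S = k" and T: "finite T" "card T = k" and "card (S \<inter> T) \<le> 1"
  shows "(\<integral>x. remainder S x * remainder T x \<partial>sample UNIV) = 0"
proof -
  obtain i where i: "i \<in> S" "S \<inter> T \<subseteq> {i}"
  proof (cases "S \<inter> T = {}")
    case True
    then show ?thesis using that S k_pos by (metis card.empty empty_subsetI equals0I not_one_le_zero)
  next
    case False
    then have "card (S \<inter> T) = 1" using assms by (simp add: card_gt_0_iff le_antisym Suc_leI)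
    then show ?thesis using that by (metis Int_iff card_1_singletonE order_refl singletonI)
  qed
  show ?thesis
  proof (rule remainder_orthogonal[OF S i(1), of "insert i T"])
    show "remainder T (restrict x (insert i T)) = remainder T x" for x
      using T by (intro remainder_restrict) auto
    show "remainder T \<in> borel_measurable (sample (insert i T))"
      by (rule measurable_remainder[OF T]) auto
    show "\<bar>remainder T x\<bar> \<le> remainder_bound" for x
      by (rule remainder_bounded[OF T])
  qed (use T(1) i in auto)
qed

lemma remainder_projection_orthogonal:
  assumes S: "finite S" "card S = k"
  shows "(\<integral>x. remainder S x * (projection (x j) - kernel_mean) \<partial>sample UNIV) = 0"
proof -
  obtain i where i: "i \<in> S" "j \<in> S \<longrightarrow> j = i"
    using S k_pos by (metis card.empty equals0I not_one_le_zero)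
  show ?thesis
    by (rule remainder_orthogonal[OF S i(1), of "{i, j}" _ "2 * B"]) (use i centered_projection_bounded in auto)
qed

definition projection_variance :: real where
  "projection_variance = (\<integral>p. (projection p - kernel_mean)\<^sup>2 \<partial>D)"

lemma projection_component_facts:
  shows "integrable (sample UNIV) (\<lambda>x. (projection (x i) - kernel_mean) * (projection (x j) - kernel_mean))"
    and "(\<integral>x. (projection (x i) - kernel_mean) * (projection (x j) - kernel_mean) \<partial>sample UNIV) =
      (if i = j then projection_variance else 0)"
proof -
  have bb: "\<bar>(projection p - kernel_mean) * (projection q - kernel_mean)\<bar> \<le> 2 * B * (2 * B)" for p q
    unfolding abs_mult using bound_nonneg by (intro mult_mono centered_projection_bounded) auto
  show int: "integrable (sample UNIV) (\<lambda>x. (projection (x i) - kernel_mean) * (projection (x j) - kernel_mean))" for i j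
    by (rule integrable_sample_bounded[OF _ bb]) measurable
  show "(\<integral>x. (projection (x i) - kernel_mean) * (projection (x j) - kernel_mean) \<partial>sample UNIV) =
      (if i = j then projection_variance else 0)"
  proof (cases "i = j")
    case True
    have "projection_variance = (\<integral>p. (projection p - kernel_mean)\<^sup>2 \<partial>distr (sample UNIV) D (\<lambda>x. x i))"
      unfolding projection_variance_def by (subst distr_PiM_component) (auto simp: prob_space_axioms)
    also have "\<dots> = (\<integral>x. (projection (x i) - kernel_mean)\<^sup>2 \<partial>sample UNIV)"
      by (rule integral_distr) auto
    finally show ?thesis using True by (simp add: power2_eq_square)
  next
    case False
    have m: "(\<lambda>x. (projection (x i) - kernel_mean) * (projection (x j) - kernel_mean)) \<in> borel_measurable (sample {i, j})"
      by measurable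
    have "(\<integral>x. (projection (x i) - kernel_mean) * (projection (x j) - kernel_mean) \<partial>sample UNIV) =
      (\<integral>x. (projection (x i) - kernel_mean) * (projection (x j) - kernel_mean) \<partial>sample {i, j})"
      by (rule expectation_sample_restrict[OF m]) auto
    also have "\<dots> = (\<integral>x. (\<integral>q. (projection ((x(i := q)) i) - kernel_mean) * (projection ((x(i := q)) j) - kernel_mean) \<partial>D) \<partial>sample {j})"
      using False by (intro P.product_integral_insert integrable_sample_bounded[OF m bb]) auto
    also have "\<dots> = 0"
      using False by (simp add: integral_projection prob_space)
    finally show ?thesis using False by simp
  qed
qed


section \<open>Hoeffding's central limit theorem for U-statistics\<close>

definition subsets :: "nat \<Rightarrow> nat set set" where
  "subsets n = {S. S \<subseteq> {1..n} \<and> card S = k}"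

lemma subsetsD:
  assumes "S \<in> subsets n"
  shows "finite S" "card S = k" "S \<subseteq> {1..n}"
  using assms by (auto simp: subsets_def intro: finite_subset)

lemma finite_subsets [simp]: "finite (subsets n)"
  by (simp add: subsets_def)

lemma card_subsets: "card (subsets n) = n choose k"
  unfolding subsets_def by (simp add: n_subsets)

text \<open>The U-statistic of the kernel, without normalization.\<close>

definition ustat :: "nat \<Rightarrow> (nat \<Rightarrow> 'a) \<Rightarrow> real" where
  "ustat n x = (\<Sum>S\<in>subsets n. h S x)"

definition linear_part :: "nat \<Rightarrow> (nat \<Rightarrow> 'a) \<Rightarrow> real" where
  "linear_part n x = (\<Sum>i\<in>{1..n}. projection (x i) - kernel_mean)"

definition remainder_part :: "nat \<Rightarrow> (nat \<Rightarrow> 'a) \<Rightarrow> real" where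
  "remainder_part n x = (\<Sum>S\<in>subsets n. remainder S x)"

lemma card_subsets_containing:
  assumes "finite A" "A \<subseteq> {1..n}" "card A \<le> k"
  shows "card {S \<in> subsets n. A \<subseteq> S} = (n - card A) choose (k - card A)"
proof -
  have "bij_betw (\<lambda>S. S \<union> A) {S. S \<subseteq> {1..n} - A \<and> card S = k - card A} {S \<in> subsets n. A \<subseteq> S}"
  proof (rule bij_betw_byWitness[where f' = "\<lambda>S. S - A"])
    show "(\<lambda>S. S \<union> A) ` {S. S \<subseteq> {1..n} - A \<and> card S = k - card A} \<subseteq> {S \<in> subsets n. A \<subseteq> S}"
    proof clarify
      fix S assume S: "S \<subseteq> {1..n} - A" "card S = k - card A"
      then have "card (S \<union> A) = card S + card A"
        using assms(1) by (intro card_Un_disjoint) (auto intro: finite_subset)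
      then show "S \<union> A \<in> subsets n \<and> A \<subseteq> S \<union> A"
        using S assms by (auto simp: subsets_def)
    qed
    show "(\<lambda>S. S - A) ` {S \<in> subsets n. A \<subseteq> S} \<subseteq> {S. S \<subseteq> {1..n} - A \<and> card S = k - card A}"
      using assms(1) by (auto simp: subsets_def card_Diff_subset)
  qed auto
  then have "card {S \<in> subsets n. A \<subseteq> S} = card {S. S \<subseteq> {1..n} - A \<and> card S = k - card A}"
    by (simp add: bij_betw_same_card)
  also have "\<dots> = (n - card A) choose (k - card A)"
    using assms by (simp add: n_subsets card_Diff_subset)
  finally show ?thesis .
qed

text \<open>Each index lies in \<open>(n - 1) choose (k - 1)\<close> of the sets, so the projections add up to a
  multiple of the linear part.\<close>

lemma hoeffding_decomposition:
  "ustat n x - real (n choose k) * kernel_mean =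
     real ((n - 1) choose (k - 1)) * linear_part n x + remainder_part n x"
proof -
  have "(\<Sum>S\<in>subsets n. \<Sum>i\<in>S. projection (x i) - kernel_mean) =
     (\<Sum>S\<in>subsets n. \<Sum>i\<in>{i\<in>{1..n}. i \<in> S}. projection (x i) - kernel_mean)"
    by (intro sum.cong) (auto simp: subsets_def)
  also have "\<dots> = (\<Sum>i\<in>{1..n}. \<Sum>S\<in>{S\<in>subsets n. i \<in> S}. projection (x i) - kernel_mean)"
    by (rule sum.swap_restrict) auto
  also have "\<dots> = (\<Sum>i\<in>{1..n}. real ((n - 1) choose (k - 1)) * (projection (x i) - kernel_mean))"
  proof (intro sum.cong refl)
    fix i assume "i \<in> {1..n}"
    then have "card {S\<in>subsets n. i \<in> S} = (n - 1) choose (k - 1)"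
      using card_subsets_containing[of "{i}" n] k_pos by simp
    then show "(\<Sum>S\<in>{S\<in>subsets n. i \<in> S}. projection (x i) - kernel_mean) =
       real ((n - 1) choose (k - 1)) * (projection (x i) - kernel_mean)" by simp
  qed
  finally show ?thesis
    by (simp add: ustat_def remainder_part_def remainder_def linear_part_def sum_subtractf card_subsets
        sum_distrib_left right_diff_distrib)
qed

lemma measurable_ustat [measurable]: "ustat n \<in> borel_measurable (sample UNIV)"
  unfolding ustat_def[abs_def]
  by (intro borel_measurable_sum measurable_kernel') (auto dest: subsetsD)

lemma measurable_linear_part [measurable]: "linear_part n \<in> borel_measurable (sample UNIV)"
  unfolding linear_part_def[abs_def] by measurable

lemma measurable_remainder_part [measurable]: "remainder_part n \<in> borel_measurable (sample UNIV)"
  unfolding remainder_part_def[abs_def]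
  by (intro borel_measurable_sum measurable_remainder) (auto dest: subsetsD)

lemma expectation_ustat: "(\<integral>x. ustat n x \<partial>sample UNIV) = real (n choose k) * kernel_mean"
proof -
  have "(\<integral>x. ustat n x \<partial>sample UNIV) = (\<Sum>S\<in>subsets n. (\<integral>x. h S x \<partial>sample UNIV))"
    unfolding ustat_def by (intro Bochner_Integration.integral_sum integrable_kernel) (auto dest: subsetsD)
  also have "\<dots> = (\<Sum>S\<in>subsets n. kernel_mean)"
  proof (intro sum.cong refl)
    fix S assume "S \<in> subsets n"
    note S = subsetsD[OF this]
    have "(\<integral>x. h S x \<partial>sample UNIV) = (\<integral>x. h S x \<partial>sample S)"
      using S by (intro expectation_sample_restrict measurable_kernel) (auto simp: kernel_restrict)
    then show "(\<integral>x. h S x \<partial>sample UNIV) = kernel_mean"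
      using integral_kernel S by simp
  qed
  finally show ?thesis by (simp add: card_subsets)
qed

lemma linear_part_squared:
  "integrable (sample UNIV) (\<lambda>x. (linear_part n x)\<^sup>2)"
  "(\<integral>x. (linear_part n x)\<^sup>2 \<partial>sample UNIV) = real n * projection_variance"
proof -
  have eq: "(linear_part n x)\<^sup>2 = (\<Sum>i\<in>{1..n}. \<Sum>j\<in>{1..n}. (projection (x i) - kernel_mean) * (projection (x j) - kernel_mean))" for x
    by (simp add: linear_part_def power2_eq_square sum_product)
  show "integrable (sample UNIV) (\<lambda>x. (linear_part n x)\<^sup>2)"
    unfolding eq by (intro Bochner_Integration.integrable_sum projection_component_facts)
  have "(\<integral>x. (linear_part n x)\<^sup>2 \<partial>sample UNIV) = (\<Sum>i\<in>{1..n}. \<Sum>j\<in>{1..n}. if i = j then projection_variance else 0)"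
    unfolding eq
    by (subst Bochner_Integration.integral_sum, intro Bochner_Integration.integrable_sum projection_component_facts,
        intro sum.cong refl, subst Bochner_Integration.integral_sum, intro projection_component_facts,
        intro sum.cong refl projection_component_facts)
  also have "\<dots> = real n * projection_variance"
    by simp
  finally show "(\<integral>x. (linear_part n x)\<^sup>2 \<partial>sample UNIV) = real n * projection_variance" .
qed

lemma integrable_remainder_projection:
  assumes "finite S" "card S = k"
  shows "integrable (sample UNIV) (\<lambda>x. remainder S x * (projection (x j) - kernel_mean))"
proof (rule integrable_sample_bounded)
  show "\<bar>remainder S x * (projection (x j) - kernel_mean)\<bar> \<le> remainder_bound * (2 * B)" for x
    unfolding abs_mult
    using order_trans[OF abs_ge_zero remainder_bounded[OF assms]]
    by (intro mult_mono centered_projection_bounded remainder_bounded assms) auto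
qed (use assms in measurable)

lemma linear_remainder_orthogonal:
  "integrable (sample UNIV) (\<lambda>x. remainder_part n x * linear_part n x)"
  "(\<integral>x. remainder_part n x * linear_part n x \<partial>sample UNIV) = 0"
proof -
  have eq: "remainder_part n x * linear_part n x = (\<Sum>S\<in>subsets n. \<Sum>j\<in>{1..n}. remainder S x * (projection (x j) - kernel_mean))" for x
    by (simp add: remainder_part_def linear_part_def sum_product)
  show "integrable (sample UNIV) (\<lambda>x. remainder_part n x * linear_part n x)"
    unfolding eq by (intro Bochner_Integration.integrable_sum integrable_remainder_projection) (auto dest: subsetsD)
  have "(\<integral>x. remainder_part n x * linear_part n x \<partial>sample UNIV) =
      (\<Sum>S\<in>subsets n. \<Sum>j\<in>{1..n}. (\<integral>x. remainder S x * (projection (x j) - kernel_mean) \<partial>sample UNIV))"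
    unfolding eq
    by (subst Bochner_Integration.integral_sum, intro Bochner_Integration.integrable_sum integrable_remainder_projection;
        (auto dest: subsetsD)?)
       (intro sum.cong refl, subst Bochner_Integration.integral_sum, auto intro!: integrable_remainder_projection dest: subsetsD)
  also have "\<dots> = 0"
    by (intro sum.neutral ballI remainder_projection_orthogonal) (auto dest: subsetsD)
  finally show "(\<integral>x. remainder_part n x * linear_part n x \<partial>sample UNIV) = 0" .
qed

lemma integrable_remainder_remainder:
  assumes "finite S" "card S = k" "finite T" "card T = k"
  shows "integrable (sample UNIV) (\<lambda>x. remainder S x * remainder T x)"
    "\<bar>\<integral>x. remainder S x * remainder T x \<partial>sample UNIV\<bar> \<le> remainder_bound\<^sup>2"
proof -
  interpret U: prob_space "sample UNIV" by (rule prob_space_sample)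
  have b: "\<bar>remainder S x * remainder T x\<bar> \<le> remainder_bound\<^sup>2" for x
    unfolding abs_mult power2_eq_square
    using order_trans[OF abs_ge_zero remainder_bounded[OF assms(1,2)]]
    by (intro mult_mono remainder_bounded assms) auto
  show int: "integrable (sample UNIV) (\<lambda>x. remainder S x * remainder T x)"
    by (rule integrable_sample_bounded[OF _ b]) (use assms in measurable)
  have "\<bar>\<integral>x. remainder S x * remainder T x \<partial>sample UNIV\<bar> \<le> (\<integral>x. \<bar>remainder S x * remainder T x\<bar> \<partial>sample UNIV)"
    by (rule integral_abs_bound)
  also have "\<dots> \<le> (\<integral>x. remainder_bound\<^sup>2 \<partial>sample UNIV)"
    using int b by (intro integral_mono integrable_abs) auto
  finally show "\<bar>\<integral>x. remainder S x * remainder T x \<partial>sample UNIV\<bar> \<le> remainder_bound\<^sup>2"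
    by (simp add: prob_space.prob_space[OF prob_space_sample])
qed

text \<open>A pair of sets sharing two indices is determined by these indices and the remaining \<open>k - 2\<close>
  elements of either set. The factor \<open>(n - 1)\<^sup>2\<close> allows the bound to be stated with the
  coefficient of the linear part, through \<open>(n - 1) ((n - 2) choose (k - 2)) =
  (k - 1) ((n - 1) choose (k - 1))\<close>.\<close>

lemma card_overlapping_pairs:
  "card {(S, T) \<in> subsets n \<times> subsets n. 2 \<le> card (S \<inter> T)} * (n - 1)\<^sup>2 \<le> n\<^sup>2 * ((k - 1) * ((n - 1) choose (k - 1)))\<^sup>2"
proof (cases "2 \<le> k \<and> 2 \<le> n")
  case False
  then have "{(S, T) \<in> subsets n \<times> subsets n. 2 \<le> card (S \<inter> T)} = {}"
  proof -
    have "card (S \<inter> T) \<le> k \<and> card (S \<inter> T) \<le> n" if "S \<in> subsets n" "T \<in> subsets n" for S T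
      using card_mono[of S "S \<inter> T"] card_mono[of "{1..n}" "S \<inter> T"] subsetsD[OF that(1)] by auto
    then show ?thesis using False by fastforce
  qed
  then show ?thesis by (simp only: card.empty)
next
  case True
  define C where "C i j = {S \<in> subsets n. {i, j} \<subseteq> S}" for i j
  have cardC: "card (C i j) = (n - 2) choose (k - 2)" if "i \<in> {1..n}" "j \<in> {1..n}" "i \<noteq> j" for i j
    unfolding C_def using card_subsets_containing[of "{i, j}" n] that True by (simp add: numeral_2_eq_2)
  let ?I = "{(i, j) \<in> {1..n} \<times> {1..n}. i \<noteq> j}"
  \<comment> \<open>\<open>C i j\<close> collects the sets that contain both \<open>i\<close> and \<open>j\<close>.\<close>
  have finite_I: "finite ?I"
    by (rule finite_subset[of _ "{1..n} \<times> {1..n}"]) auto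
  have "{(S, T) \<in> subsets n \<times> subsets n. 2 \<le> card (S \<inter> T)} \<subseteq> (\<Union>(i, j)\<in>?I. C i j \<times> C i j)"
  proof clarify
    fix S T assume ST: "S \<in> subsets n" "T \<in> subsets n" "2 \<le> card (S \<inter> T)"
    then obtain i j where ij: "i \<in> S \<inter> T" "j \<in> S \<inter> T" "i \<noteq> j"
      by (metis One_nat_def Suc_1 card_le_Suc0_iff_eq finite_Int not_less_eq_eq subsetsD(1))
    then show "(S, T) \<in> (\<Union>(i, j)\<in>?I. C i j \<times> C i j)"
      using ST ij subsetsD(3)[OF ST(1)] by (intro UN_I[of "(i, j)"]) (auto simp: C_def)
  qed
  then have "card {(S, T) \<in> subsets n \<times> subsets n. 2 \<le> card (S \<inter> T)} \<le> card (\<Union>(i, j)\<in>?I. C i j \<times> C i j)"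
    by (intro card_mono finite_UN_I finite_I) (auto simp: C_def)
  also have "\<dots> \<le> (\<Sum>(i, j)\<in>?I. card (C i j \<times> C i j))"
    using card_UN_le[OF finite_I, of "\<lambda>(i, j). C i j \<times> C i j"] by (simp only: case_prod_unfold)
  also have "\<dots> = (\<Sum>(i, j)\<in>?I. ((n - 2) choose (k - 2))\<^sup>2)"
    by (intro sum.cong refl) (auto simp: card_cartesian_product cardC power2_eq_square)
  also have "\<dots> \<le> n\<^sup>2 * ((n - 2) choose (k - 2))\<^sup>2"
  proof -
    have "card ?I \<le> card ({1..n} \<times> {1..n})" by (intro card_mono) auto
    then show ?thesis by (simp add: power2_eq_square case_prod_unfold)
  qed
  finally have "card {(S, T) \<in> subsets n \<times> subsets n. 2 \<le> card (S \<inter> T)} * (n - 1)\<^sup>2 \<le> n\<^sup>2 * ((n - 2) choose (k - 2))\<^sup>2 * (n - 1)\<^sup>2"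
    by (rule mult_right_mono) simp
  moreover have "(n - 1) * ((n - 2) choose (k - 2)) = (k - 1) * ((n - 1) choose (k - 1))"
    using Suc_times_binomial[of "k - 2" "n - 2"] True by (simp add: Suc_diff_Suc numeral_2_eq_2)
  moreover have "n\<^sup>2 * ((n - 2) choose (k - 2))\<^sup>2 * (n - 1)\<^sup>2 = n\<^sup>2 * ((n - 1) * ((n - 2) choose (k - 2)))\<^sup>2"
    by (simp only: power_mult_distrib mult_ac)
  ultimately show ?thesis by (simp only:)
qed

text \<open>Expanding the square, only the pairs of sets that share two indices contribute.\<close>

lemma remainder_part_squared:
  "integrable (sample UNIV) (\<lambda>x. (remainder_part n x)\<^sup>2)"
  "(\<integral>x. (remainder_part n x)\<^sup>2 \<partial>sample UNIV) * (real (n - 1))\<^sup>2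
     \<le> remainder_bound\<^sup>2 * (real n * (real (k - 1) * real ((n - 1) choose (k - 1))))\<^sup>2"
proof -
  have eq: "(remainder_part n x)\<^sup>2 = (\<Sum>(S, T)\<in>subsets n \<times> subsets n. remainder S x * remainder T x)" for x
    by (simp add: remainder_part_def power2_eq_square sum_product sum.cartesian_product)
  show "integrable (sample UNIV) (\<lambda>x. (remainder_part n x)\<^sup>2)"
    unfolding eq case_prod_unfold
    by (intro Bochner_Integration.integrable_sum integrable_remainder_remainder) (auto dest: subsetsD)
  let ?Q = "{(S, T) \<in> subsets n \<times> subsets n. 2 \<le> card (S \<inter> T)}"
  have "(\<integral>x. (remainder_part n x)\<^sup>2 \<partial>sample UNIV) =
      (\<Sum>(S, T)\<in>subsets n \<times> subsets n. (\<integral>x. remainder S x * remainder T x \<partial>sample UNIV))"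
    unfolding eq case_prod_unfold
    by (intro Bochner_Integration.integral_sum integrable_remainder_remainder) (auto dest: subsetsD)
  also have "\<dots> = (\<Sum>(S, T)\<in>?Q. (\<integral>x. remainder S x * remainder T x \<partial>sample UNIV))"
    by (intro sum.mono_neutral_right) (auto intro!: remainders_orthogonal dest: subsetsD)
  also have "\<dots> \<le> (\<Sum>(S, T)\<in>?Q. remainder_bound\<^sup>2)"
    by (intro sum_mono) (auto intro!: order_trans[OF abs_ge_self integrable_remainder_remainder(2)] dest: subsetsD)
  also have "\<dots> = real (card ?Q) * remainder_bound\<^sup>2"
    by (simp add: case_prod_unfold)
  finally have "(\<integral>x. (remainder_part n x)\<^sup>2 \<partial>sample UNIV) * (real (n - 1))\<^sup>2 \<le> real (card ?Q) * remainder_bound\<^sup>2 * (real (n - 1))\<^sup>2"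
    by (rule mult_right_mono) simp
  also have "\<dots> = remainder_bound\<^sup>2 * (real (card ?Q) * (real (n - 1))\<^sup>2)"
    by (simp only: mult_ac)
  also have "\<dots> \<le> remainder_bound\<^sup>2 * (real n * (real (k - 1) * real ((n - 1) choose (k - 1))))\<^sup>2"
  proof (rule mult_left_mono)
    have "real (card ?Q * (n - 1)\<^sup>2) \<le> real (n\<^sup>2 * ((k - 1) * ((n - 1) choose (k - 1)))\<^sup>2)"
      by (rule of_nat_mono[OF card_overlapping_pairs])
    then show "real (card ?Q) * (real (n - 1))\<^sup>2 \<le> (real n * (real (k - 1) * real ((n - 1) choose (k - 1))))\<^sup>2"
      by (simp only: of_nat_mult of_nat_power power_mult_distrib)
  qed simp
  finally show "(\<integral>x. (remainder_part n x)\<^sup>2 \<partial>sample UNIV) * (real (n - 1))\<^sup>2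
     \<le> remainder_bound\<^sup>2 * (real n * (real (k - 1) * real ((n - 1) choose (k - 1))))\<^sup>2" .
qed


text \<open>The linear part and the remainder part are orthogonal. This covers both the variance of the
  statistic and its distance from the normalized linear part.\<close>

lemma linear_combination_squared:
  "integrable (sample UNIV) (\<lambda>x. (a * linear_part n x + b * remainder_part n x)\<^sup>2)"
  "(\<integral>x. (a * linear_part n x + b * remainder_part n x)\<^sup>2 \<partial>sample UNIV) =
     a\<^sup>2 * (real n * projection_variance) + b\<^sup>2 * (\<integral>x. (remainder_part n x)\<^sup>2 \<partial>sample UNIV)"
proof -
  have eq: "(a * linear_part n x + b * remainder_part n x)\<^sup>2 =
      a\<^sup>2 * (linear_part n x)\<^sup>2 + b\<^sup>2 * (remainder_part n x)\<^sup>2 + (2 * a * b) * (remainder_part n x * linear_part n x)" for x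
    by (simp add: power2_sum power_mult_distrib mult_ac)
  note ints = linear_part_squared(1)[of n] remainder_part_squared(1)[of n] linear_remainder_orthogonal(1)[of n]
  show "integrable (sample UNIV) (\<lambda>x. (a * linear_part n x + b * remainder_part n x)\<^sup>2)"
    unfolding eq by (intro Bochner_Integration.integrable_add integrable_mult_right ints)
  have "(\<integral>x. (a * linear_part n x + b * remainder_part n x)\<^sup>2 \<partial>sample UNIV) =
     a\<^sup>2 * (\<integral>x. (linear_part n x)\<^sup>2 \<partial>sample UNIV) + b\<^sup>2 * (\<integral>x. (remainder_part n x)\<^sup>2 \<partial>sample UNIV)
     + (2 * a * b) * (\<integral>x. remainder_part n x * linear_part n x \<partial>sample UNIV)"
    unfolding eq
    by (subst Bochner_Integration.integral_add Bochner_Integration.integral_mult_right_zero;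
        (intro Bochner_Integration.integrable_add integrable_mult_right ints)?)+ simp
  then show "(\<integral>x. (a * linear_part n x + b * remainder_part n x)\<^sup>2 \<partial>sample UNIV) =
     a\<^sup>2 * (real n * projection_variance) + b\<^sup>2 * (\<integral>x. (remainder_part n x)\<^sup>2 \<partial>sample UNIV)"
    by (simp add: linear_part_squared(2) linear_remainder_orthogonal(2))
qed

lemma variance_ustat:
  "(\<integral>x. (ustat n x - (\<integral>x. ustat n x \<partial>sample UNIV))\<^sup>2 \<partial>sample UNIV) =
     (real ((n - 1) choose (k - 1)))\<^sup>2 * (real n * projection_variance)
     + (\<integral>x. (remainder_part n x)\<^sup>2 \<partial>sample UNIV)"
  using linear_combination_squared(2)[of "real ((n - 1) choose (k - 1))" n 1]
  by (simp add: expectation_ustat hoeffding_decomposition)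

lemma linear_part_clt:
  assumes "0 < projection_variance"
  shows "weak_conv_m (\<lambda>n. distr (sample UNIV) borel (\<lambda>x. linear_part n x / sqrt (real n * projection_variance)))
           std_normal_distribution"
proof -
  \<comment> \<open>The summands of the linear part are numbered from \<open>1\<close>, those of the central limit theorem from \<open>0\<close>.\<close>
  let ?X = "\<lambda>i x. projection (x (Suc i)) - kernel_mean"
  have "weak_conv_m (\<lambda>n. distr (sample UNIV) borel (\<lambda>x. (\<Sum>i<n. ?X i x) / sqrt (real n * (sqrt projection_variance)\<^sup>2)))
           std_normal_distribution"
  proof (rule P.central_limit_theorem_zero_mean)
    have "P.indep_vars (\<lambda>_. D) (\<lambda>i x. x (Suc i)) UNIV"
    proof (subst P.indep_vars_iff_distr_eq_PiM)
      show "distr (sample UNIV) (PiM UNIV (\<lambda>_. D)) (\<lambda>x. \<lambda>i\<in>UNIV. x (Suc i)) =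
          PiM UNIV (\<lambda>i. distr (sample UNIV) D (\<lambda>x. x (Suc i)))"
      proof -
        have "distr (sample UNIV) D (\<lambda>x. x (Suc i)) = D" for i
          by (rule distr_PiM_component) (simp_all add: prob_space_axioms)
        then show ?thesis
          using distr_PiM_reindex[of UNIV "\<lambda>_. D" Suc UNIV] prob_space_axioms by simp
      qed
    qed auto
    then show "P.indep_vars (\<lambda>_. borel) ?X UNIV"
      by (rule P.indep_vars_compose2) measurable
    show "(\<integral>x. ?X i x \<partial>sample UNIV) = 0" for i
      using integral_projection_component[of "Suc i" UNIV] by (simp add: prob_space.prob_space[OF prob_space_sample])
    then show "(\<integral>x. (?X i x - (\<integral>x. ?X i x \<partial>sample UNIV))\<^sup>2 \<partial>sample UNIV) = (sqrt projection_variance)\<^sup>2" for i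
      using projection_component_facts(2)[of "Suc i" "Suc i"] assms by (simp add: power2_eq_square)
    show "integrable (sample UNIV) (\<lambda>x. (?X i x)\<^sup>2)" for i
      using projection_component_facts(1)[of "Suc i" "Suc i"] by (simp add: power2_eq_square)
    show "distr (sample UNIV) borel (?X i) = distr D borel (\<lambda>p. projection p - kernel_mean)" for i
    proof -
      have "distr D borel (\<lambda>p. projection p - kernel_mean) = distr (distr (sample UNIV) D (\<lambda>x. x (Suc i))) borel (\<lambda>p. projection p - kernel_mean)"
        by (subst distr_PiM_component) (auto simp: prob_space_axioms)
      also have "\<dots> = distr (sample UNIV) borel (?X i)"
        by (subst distr_distr) (auto simp: comp_def)
      finally show ?thesis ..
    qed
  qed (use assms in auto)
  then show ?thesis
    using assms by (simp add: linear_part_def sum.atLeast1_atMost_eq)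
qed

lemma remainder_negligible:
  assumes "0 < projection_variance"
  shows "(\<lambda>n. (\<integral>x. (remainder_part n x)\<^sup>2 \<partial>sample UNIV) /
     ((real ((n - 1) choose (k - 1)))\<^sup>2 * (real n * projection_variance))) \<longlonglongrightarrow> 0"
proof (rule tendsto_sandwich[OF _ _ tendsto_const])
  let ?r = "\<lambda>n. \<integral>x. (remainder_part n x)\<^sup>2 \<partial>sample UNIV"
  let ?C = "\<lambda>n. real ((n - 1) choose (k - 1))"
  define K where "K = remainder_bound\<^sup>2 * (real (k - 1))\<^sup>2 / projection_variance"
  show "\<forall>\<^sub>F n in sequentially. 0 \<le> ?r n / ((?C n)\<^sup>2 * (real n * projection_variance))"
    using assms by (intro always_eventually) auto
  show "\<forall>\<^sub>F n in sequentially. ?r n / ((?C n)\<^sup>2 * (real n * projection_variance)) \<le> K * (real n / (real n - 1)\<^sup>2)"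
    using eventually_ge_at_top[of "max 2 k"]
  proof eventually_elim
    case (elim n)
    then have n: "2 \<le> n" "k \<le> n" by auto
    have C: "0 < ?C n" using n k_pos by simp
    have n1: "real (n - 1) = real n - 1" "0 < real n - 1" "0 < real n" using n by auto
    have "?r n * (real n - 1)\<^sup>2 \<le> remainder_bound\<^sup>2 * (real n * (real (k - 1) * ?C n))\<^sup>2"
      using remainder_part_squared(2)[of n] n1 by simp
    also have "\<dots> = (K * real n) * ((?C n)\<^sup>2 * (real n * projection_variance))"
      using assms by (simp add: K_def power_mult_distrib power2_eq_square)
    finally have "?r n \<le> (K * real n) * ((?C n)\<^sup>2 * (real n * projection_variance)) / (real n - 1)\<^sup>2"
      using n1 by (simp add: pos_le_divide_eq)
    then show ?case
      using C n1 assms by (subst pos_divide_le_eq) (auto simp: field_simps)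
  qed
  have "(\<lambda>n. real n / (real n - 1)\<^sup>2) \<longlonglongrightarrow> 0" by real_asymp
  then show "(\<lambda>n. K * (real n / (real n - 1)\<^sup>2)) \<longlonglongrightarrow> 0"
    by (rule tendsto_mult_right_zero)
qed

text \<open>Hoeffding's theorem: the standardized statistic and the standardized linear part are close in
  mean square, because the share of the linear part in the variance tends to one.\<close>

theorem ustat_clt:
  assumes pos: "0 < projection_variance"
  shows "weak_conv_m (\<lambda>n. distr (sample UNIV) borel
     (\<lambda>x. (ustat n x - (\<integral>x. ustat n x \<partial>sample UNIV)) /
        sqrt (\<integral>x. (ustat n x - (\<integral>x. ustat n x \<partial>sample UNIV))\<^sup>2 \<partial>sample UNIV))) std_normal_distribution"
proof -
  let ?C = "\<lambda>n. real ((n - 1) choose (k - 1))"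
  let ?r = "\<lambda>n. \<integral>x. (remainder_part n x)\<^sup>2 \<partial>sample UNIV"
  let ?c = "\<lambda>n. (?C n)\<^sup>2 * (real n * projection_variance)"
  define V where "V n = (\<integral>x. (ustat n x - (\<integral>x. ustat n x \<partial>sample UNIV))\<^sup>2 \<partial>sample UNIV)" for n
  have V: "V n = ?c n + ?r n" for n
    unfolding V_def by (rule variance_ustat)
  define X where "X n x = (ustat n x - (\<integral>x. ustat n x \<partial>sample UNIV)) / sqrt (V n)" for n x
  define Y where "Y n x = linear_part n x / sqrt (real n * projection_variance)" for n x
  have diff: "X n x - Y n x = (?C n / sqrt (V n) - 1 / sqrt (real n * projection_variance)) * linear_part n x
      + 1 / sqrt (V n) * remainder_part n x" for n x
    unfolding X_def Y_def expectation_ustat hoeffding_decomposition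
    by (simp add: add_divide_distrib left_diff_distrib)
  have "weak_conv_m (\<lambda>n. distr (sample UNIV) borel (X n)) std_normal_distribution"
  proof (rule P.weak_conv_m_L2_close[where Y = Y])
    show "X n \<in> borel_measurable (sample UNIV)" for n
      unfolding X_def[abs_def] by measurable
    show "Y n \<in> borel_measurable (sample UNIV)" for n
      unfolding Y_def[abs_def] by measurable
    show "integrable (sample UNIV) (\<lambda>x. (X n x - Y n x)\<^sup>2)" for n
      unfolding diff by (rule linear_combination_squared)
    show "weak_conv_m (\<lambda>n. distr (sample UNIV) borel (Y n)) std_normal_distribution"
      unfolding Y_def[abs_def] by (rule linear_part_clt[OF pos])
    \<comment> \<open>\<open>w n\<close> is the correlation of the statistic with its linear part, namely \<open>sqrt (?c n / V n)\<close>.\<close>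
    define w where "w n = 1 / sqrt (1 + ?r n / ?c n)" for n
    have "w \<longlonglongrightarrow> 1 / sqrt (1 + 0)"
      unfolding w_def[abs_def]
      by (intro tendsto_intros remainder_negligible[OF pos]) simp
    then have "(\<lambda>n. (w n - 1)\<^sup>2 + (1 - (w n)\<^sup>2)) \<longlonglongrightarrow> (1 / sqrt (1 + 0) - 1)\<^sup>2 + (1 - (1 / sqrt (1 + 0))\<^sup>2)"
      by (intro tendsto_intros)
    then have lim: "(\<lambda>n. (w n - 1)\<^sup>2 + (1 - (w n)\<^sup>2)) \<longlonglongrightarrow> 0" by simp
    have "\<forall>\<^sub>F n in sequentially. (w n - 1)\<^sup>2 + (1 - (w n)\<^sup>2) = (\<integral>x. (X n x - Y n x)\<^sup>2 \<partial>sample UNIV)"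
      using eventually_ge_at_top[of "max 1 k"]
    proof eventually_elim
      case (elim n)
      then have n: "1 \<le> n" "k \<le> n" by auto
      have C: "0 < ?C n" using n k_pos by simp
      have nz: "0 < real n * projection_variance" using n pos by simp
      have c: "0 < ?c n" by (rule mult_pos_pos[OF zero_less_power[OF C] nz])
      have r: "0 \<le> ?r n" by simp
      have V0: "0 < V n" unfolding V using c r by linarith
      have w2: "w n = ?C n * sqrt (real n * projection_variance) / sqrt (V n)"
      proof -
        have "1 + ?r n / ?c n = V n / ?c n" unfolding V add_divide_distrib by (simp only: divide_self[OF less_imp_neq[OF c, symmetric]])
        then have "w n = sqrt (?c n) / sqrt (V n)" by (simp add: w_def real_sqrt_divide)
        then show ?thesis using C by (simp add: real_sqrt_mult)
      qed
      have "(?C n / sqrt (V n) - 1 / sqrt (real n * projection_variance))\<^sup>2 * (real n * projection_variance) = (w n - 1)\<^sup>2"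
      proof -
        have "(?C n / sqrt (V n) - 1 / sqrt (real n * projection_variance)) * sqrt (real n * projection_variance) = w n - 1"
          using n pos by (simp add: w2 left_diff_distrib)
        then have "((?C n / sqrt (V n) - 1 / sqrt (real n * projection_variance)) * sqrt (real n * projection_variance))\<^sup>2 = (w n - 1)\<^sup>2"
          by (rule arg_cong)
        then show ?thesis using n pos unfolding power_mult_distrib by simp
      qed
      moreover have "(1 / sqrt (V n))\<^sup>2 * ?r n = 1 - (w n)\<^sup>2"
      proof -
        have "(w n)\<^sup>2 = ?c n / V n"
          using V0 n pos by (simp add: w2 power_divide power_mult_distrib)
        then show ?thesis using V0 V[of n] by (simp add: power_divide field_simps)
      qed
      ultimately show ?case
        unfolding diff linear_combination_squared(2) by simp
    qed
    then show "(\<lambda>n. \<integral>x. (X n x - Y n x)\<^sup>2 \<partial>sample UNIV) \<longlonglongrightarrow> 0"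
      using lim tendsto_cong by force
    show "real_distribution std_normal_distribution" by (rule real_dist_normal_dist)
  qed
  then show ?thesis unfolding X_def[abs_def] V_def .
qed

end

section \<open>Increasing subsequences as chains of points\<close>

text \<open>The indicator of a chain in the product order of the plane. Points with equal
  abscissae count as comparable; below this has probability zero.\<close>

definition chain_kernel :: "nat set \<Rightarrow> (nat \<Rightarrow> real \<times> real) \<Rightarrow> real" where
  "chain_kernel S x = of_bool (\<forall>i\<in>S. \<forall>j\<in>S. fst (x i) < fst (x j) \<longrightarrow> snd (x i) < snd (x j))"

lemma Z_eq_chain_sum:
  "Z n k \<pi> = (\<Sum>S\<in>{S. S \<subseteq> {1..n} \<and> card S = k}. chain_kernel S (\<lambda>i. (real i, real (\<pi> i))))"
proof -
  have "sorted_wrt (<) (map \<pi> is) \<longleftrightarrow> (\<forall>i\<in>set is. \<forall>j\<in>set is. i < j \<longrightarrow> \<pi> i < \<pi> j)"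
    if "is \<in> index_tuples n k" for "is"
  proof -
    have sorted: "sorted_wrt (<) is" using that by (simp add: index_tuples_def)
    then have less: "a < b" if "a < length is" "b < length is" "is ! a < is ! b" for a b
      using that by (metis linorder_cases not_less_iff_gr_or_eq sorted_wrt_nth_less)
    show ?thesis
    proof
      assume L: "sorted_wrt (<) (map \<pi> is)"
      have "\<pi> (is ! a) < \<pi> (is ! b)" if "a < length is" "b < length is" "is ! a < is ! b" for a b
        using sorted_wrt_nth_less[OF L, of a b] less[OF that] that by simp
      then show "\<forall>i\<in>set is. \<forall>j\<in>set is. i < j \<longrightarrow> \<pi> i < \<pi> j"
        by (auto simp: in_set_conv_nth)
    next
      assume R: "\<forall>i\<in>set is. \<forall>j\<in>set is. i < j \<longrightarrow> \<pi> i < \<pi> j"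
      show "sorted_wrt (<) (map \<pi> is)"
        unfolding sorted_wrt_map
        by (rule sorted_wrt_mono_rel[OF _ sorted]) (use R in auto)
    qed
  qed
  then have "Z n k \<pi> = (\<Sum>is\<in>index_tuples n k. chain_kernel (set is) (\<lambda>i. (real i, real (\<pi> i))))"
    unfolding Z_def chain_kernel_def by (intro sum.cong refl arg_cong[where f = of_bool]) auto
  also have "\<dots> = (\<Sum>S\<in>{S. S \<subseteq> {1..n} \<and> card S = k}. chain_kernel S (\<lambda>i. (real i, real (\<pi> i))))"
    by (rule sum.reindex_bij_betw[OF bij_betw_index_tuples])
  finally show ?thesis .
qed

text \<open>Extended by the identity so as to be a permutation in the sense of \<open>permutes\<close>.\<close>

definition rank_of :: "nat \<Rightarrow> (nat \<Rightarrow> real) \<Rightarrow> nat \<Rightarrow> nat" where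
  "rank_of n u i = (if i \<in> {1..n} then card {j \<in> {1..n}. u j \<le> u i} else i)"

lemma rank_of_less_iff:
  assumes "inj_on u {1..n}" "i \<in> {1..n}" "j \<in> {1..n}"
  shows "rank_of n u i < rank_of n u j \<longleftrightarrow> u i < u j"
proof -
  have mono: "rank_of n u i < rank_of n u j" if "u i < u j" "i \<in> {1..n}" "j \<in> {1..n}" for i j
  proof -
    have "{l \<in> {1..n}. u l \<le> u i} \<subseteq> {l \<in> {1..n}. u l \<le> u j}" using that(1) by auto
    moreover have "j \<notin> {l \<in> {1..n}. u l \<le> u i}" "j \<in> {l \<in> {1..n}. u l \<le> u j}" using that by auto
    ultimately have "{l \<in> {1..n}. u l \<le> u i} \<subset> {l \<in> {1..n}. u l \<le> u j}" by blast
    then show ?thesis using that by (simp add: rank_of_def psubset_card_mono)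
  qed
  show ?thesis
    using mono[of i j] mono[of j i] assms
    by (metis inj_on_eq_iff linorder_less_linear not_less_iff_gr_or_eq)
qed

lemma rank_of_permutes:
  assumes "inj_on u {1..n}"
  shows "rank_of n u permutes {1..n}"
proof (rule bij_imp_permutes)
  have "inj_on (rank_of n u) {1..n}"
  proof (rule inj_onI)
    fix i j assume ij: "i \<in> {1..n}" "j \<in> {1..n}" "rank_of n u i = rank_of n u j"
    then have "\<not> u i < u j" "\<not> u j < u i"
      using rank_of_less_iff[OF assms, of i j] rank_of_less_iff[OF assms, of j i] by auto
    then show "i = j" using ij assms by (simp add: inj_on_eq_iff)
  qed
  moreover have "rank_of n u ` {1..n} \<subseteq> {1..n}"
  proof clarify
    fix i assume i: "i \<in> {1..n}"
    have "card {j \<in> {1..n}. u j \<le> u i} \<le> card {1..n}" by (intro card_mono) auto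
    moreover have "card {j \<in> {1..n}. u j \<le> u i} > 0" using i by (auto simp: card_gt_0_iff)
    ultimately show "rank_of n u i \<in> {1..n}" using i by (simp add: rank_of_def)
  qed
  ultimately show "bij_betw (rank_of n u) {1..n} {1..n}"
    by (simp add: bij_betw_def endo_inj_surj)
qed (auto simp: rank_of_def)

lemma bij_betw_image_subsets:
  assumes "\<rho> permutes A"
  shows "bij_betw (\<lambda>S. \<rho> ` S) {S. S \<subseteq> A \<and> card S = k} {S. S \<subseteq> A \<and> card S = k}"
proof (rule bij_betw_byWitness[where f' = "\<lambda>S. inv \<rho> ` S"])
  have *: "\<sigma> ` S \<subseteq> A \<and> card (\<sigma> ` S) = card S" if "\<sigma> permutes A" "S \<subseteq> A" for \<sigma> S
    using that permutes_image[OF that(1)] by (auto intro!: card_image permutes_inj_on)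
  show "(\<lambda>S. \<rho> ` S) ` {S. S \<subseteq> A \<and> card S = k} \<subseteq> {S. S \<subseteq> A \<and> card S = k}"
    using *[OF assms] by blast
  show "(\<lambda>S. inv \<rho> ` S) ` {S. S \<subseteq> A \<and> card S = k} \<subseteq> {S. S \<subseteq> A \<and> card S = k}"
    using *[OF permutes_inv[OF assms]] by blast
qed (use permutes_inverses[OF assms] in \<open>auto simp: image_image\<close>)

text \<open>Only the relative order of the coordinates matters, so they may be replaced by their ranks;
  renaming the points by the rank of the abscissa then makes the abscissae \<open>1, \<dots>, n\<close>.\<close>

lemma chain_sum_eq_Z_rank:
  assumes "inj_on u {1..n}" "inj_on v {1..n}" "\<pi> permutes {1..n}"
  shows "(\<Sum>S\<in>{S. S \<subseteq> {1..n} \<and> card S = k}. chain_kernel S (\<lambda>i. (u i, v (\<pi> i)))) =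
    Z n k (rank_of n v \<circ> \<pi> \<circ> inv (rank_of n u))"
proof -
  let ?K = "{S. S \<subseteq> {1..n} \<and> card S = k}" and ?\<rho> = "rank_of n v \<circ> \<pi> \<circ> inv (rank_of n u)"
  note ru = rank_of_permutes[OF assms(1)]
  have "Z n k ?\<rho> = (\<Sum>S\<in>?K. chain_kernel (rank_of n u ` S) (\<lambda>i. (real i, real (?\<rho> i))))"
    unfolding Z_eq_chain_sum by (rule sum.reindex_bij_betw[OF bij_betw_image_subsets[OF ru], symmetric])
  also have "\<dots> = (\<Sum>S\<in>?K. chain_kernel S (\<lambda>i. (u i, v (\<pi> i))))"
  proof (intro sum.cong refl)
    fix S assume "S \<in> ?K"
    then have S: "i \<in> {1..n}" "\<pi> i \<in> {1..n}" if "i \<in> S" for i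
      using that permutes_in_image[OF assms(3)] by blast+
    then show "chain_kernel (rank_of n u ` S) (\<lambda>i. (real i, real (?\<rho> i))) = chain_kernel S (\<lambda>i. (u i, v (\<pi> i)))"
      using rank_of_less_iff[OF assms(1)] rank_of_less_iff[OF assms(2)]
      by (simp add: chain_kernel_def permutes_inverses(2)[OF ru])
  qed
  finally show ?thesis ..
qed

text \<open>As \<open>\<pi>\<close> runs through all permutations, so does \<open>rank_of n v \<circ> \<pi> \<circ> inv (rank_of n u)\<close>: averaging
  over the matchings of abscissae and ordinates forgets the points themselves.\<close>

lemma sum_permutes_chain_sum:
  fixes G :: "real \<Rightarrow> real"
  assumes "inj_on u {1..n}" "inj_on v {1..n}"
  shows "(\<Sum>\<pi>\<in>{\<pi>. \<pi> permutes {1..n}}. G (\<Sum>S\<in>{S. S \<subseteq> {1..n} \<and> card S = k}. chain_kernel S (\<lambda>i. (u i, v (\<pi> i))))) =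
    (\<Sum>\<pi>\<in>{\<pi>. \<pi> permutes {1..n}}. G (Z n k \<pi>))"
proof -
  let ?P = "{\<pi>. \<pi> permutes {1..n}}"
  note ru = rank_of_permutes[OF assms(1)] and rv = rank_of_permutes[OF assms(2)]
  have "(\<Sum>\<pi>\<in>?P. G (\<Sum>S\<in>{S. S \<subseteq> {1..n} \<and> card S = k}. chain_kernel S (\<lambda>i. (u i, v (\<pi> i))))) =
     (\<Sum>\<pi>\<in>?P. G (Z n k (rank_of n v \<circ> \<pi> \<circ> inv (rank_of n u))))"
    by (intro sum.cong refl arg_cong[where f = G] chain_sum_eq_Z_rank assms) simp
  also have "\<dots> = (\<Sum>\<pi>\<in>?P. G (Z n k \<pi>))"
    by (rule sum.reindex_bij_witness[where i = "\<lambda>\<pi>. inv (rank_of n v) \<circ> \<pi> \<circ> rank_of n u" and j = "\<lambda>\<pi>. rank_of n v \<circ> \<pi> \<circ> inv (rank_of n u)"])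
       (auto intro!: permutes_compose permutes_inv ru[simplified] rv[simplified] simp: fun_eq_iff permutes_inverses[OF ru] permutes_inverses[OF rv])
  finally show ?thesis .
qed

section \<open>Uniform random points in the unit square\<close>

definition unit_uniform :: "real measure" where
  "unit_uniform = uniform_measure lborel {0..1}"

definition square_uniform :: "(real \<times> real) measure" where
  "square_uniform = unit_uniform \<Otimes>\<^sub>M unit_uniform"

lemma sets_unit_uniform [simp, measurable_cong]: "sets unit_uniform = sets borel"
  by (simp add: unit_uniform_def)

lemma space_unit_uniform [simp]: "space unit_uniform = UNIV"
  by (simp add: unit_uniform_def)

lemma emeasure_unit_uniform: "A \<in> sets borel \<Longrightarrow> emeasure unit_uniform A = emeasure lborel ({0..1} \<inter> A)"
  by (simp add: unit_uniform_def divide_ennreal_def)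

interpretation unit: prob_space unit_uniform
  unfolding unit_uniform_def by (rule prob_space_uniform_measure) auto

interpretation square: pair_prob_space unit_uniform unit_uniform ..

lemma prob_space_square_uniform: "prob_space square_uniform"
  unfolding square_uniform_def by (rule square.P.prob_space_axioms)

lemma sets_square_uniform [measurable_cong]: "sets square_uniform = sets (borel \<Otimes>\<^sub>M borel)"
  unfolding square_uniform_def by (rule sets_pair_measure_cong) simp_all

lemma emeasure_unit_uniform_singleton: "emeasure unit_uniform {a} = 0"
proof -
  have "emeasure lborel ({0..1} \<inter> {a}) \<le> emeasure lborel {a}" by (intro emeasure_mono) auto
  then show ?thesis by (simp add: emeasure_unit_uniform)
qed

lemma symmetric_kernel_chain:
  assumes "1 \<le> k"
  shows "symmetric_kernel square_uniform k chain_kernel 1"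
proof -
  interpret prob_space square_uniform by (rule prob_space_square_uniform)
  show ?thesis
  proof
    show "1 \<le> k" by fact
    fix S :: "nat set" assume S: "finite S" "card S = k"
    have [measurable]: "(\<lambda>x. fst (x i)) \<in> borel_measurable (PiM S (\<lambda>_. square_uniform))"
       "(\<lambda>x. snd (x i)) \<in> borel_measurable (PiM S (\<lambda>_. square_uniform))" if "i \<in> S" for i
      using measurable_component_singleton[OF that, of "\<lambda>_. square_uniform"]
      by (auto intro!: measurable_compose[OF _ measurable_fst] measurable_compose[OF _ measurable_snd] 
           simp: measurable_cong_sets[OF refl sets_square_uniform])
    show "chain_kernel S \<in> borel_measurable (PiM S (\<lambda>_. square_uniform))"
      unfolding chain_kernel_def[abs_def] using S(1) by measurable
    fix S' \<sigma> and x x' :: "nat \<Rightarrow> real \<times> real" assume \<sigma>: "bij_betw \<sigma> S S'" "\<And>i. i \<in> S \<Longrightarrow> x i = x' (\<sigma> i)"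
    then have "S' = \<sigma> ` S" by (simp add: bij_betw_def)
    then show "chain_kernel S x = chain_kernel S' x'"
      using \<sigma>(2) by (simp add: chain_kernel_def)
  qed (simp add: chain_kernel_def)
qed

text \<open>All coordinates are taken as one independent family, because the argument below permutes
  the ordinates while keeping the abscissae.\<close>

definition points :: "(bool \<times> nat \<Rightarrow> real) \<Rightarrow> nat \<Rightarrow> real \<times> real" where
  "points x i = (x (False, i), x (True, i))"

abbreviation coordinates :: "(bool \<times> nat \<Rightarrow> real) measure" where
  "coordinates \<equiv> PiM UNIV (\<lambda>_. unit_uniform)"

interpretation coord: product_prob_space "\<lambda>_. unit_uniform" "UNIV :: (bool \<times> nat) set"
  by standard

lemma indep_coordinates: "coord.indep_vars (\<lambda>_. unit_uniform) (\<lambda>a x. x a) UNIV"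
proof (subst coord.indep_vars_iff_distr_eq_PiM)
  have "distr coordinates unit_uniform (\<lambda>x. x a) = unit_uniform" for a
    by (rule distr_PiM_component) (simp_all add: unit.prob_space_axioms)
  then show "distr coordinates (PiM UNIV (\<lambda>_. unit_uniform)) (\<lambda>x. \<lambda>a\<in>UNIV. x a) =
      PiM UNIV (\<lambda>a. distr coordinates unit_uniform (\<lambda>x. x a))"
    by (simp add: restrict_UNIV distr_id)
qed auto

lemma distr_two_coordinates:
  assumes "a \<noteq> b"
  shows "distr coordinates square_uniform (\<lambda>x. (x a, x b)) = square_uniform"
proof -
  have "coord.indep_var unit_uniform (\<lambda>x. x a) unit_uniform (\<lambda>x. x b)"
  proof -
    have "coord.indep_var (PiM {a} (\<lambda>_. unit_uniform)) (\<lambda>x. restrict (\<lambda>c. x c) {a})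
        (PiM {b} (\<lambda>_. unit_uniform)) (\<lambda>x. restrict (\<lambda>c. x c) {b})"
      by (rule coord.indep_var_restrict[OF indep_coordinates]) (use assms in auto)
    then have "coord.indep_var unit_uniform ((\<lambda>y. y a) \<circ> (\<lambda>x. restrict (\<lambda>c. x c) {a}))
        unit_uniform ((\<lambda>y. y b) \<circ> (\<lambda>x. restrict (\<lambda>c. x c) {b}))"
      by (rule coord.indep_var_compose) (simp_all add: measurable_component_singleton)
    then show ?thesis by (simp add: comp_def)
  qed
  then have "distr coordinates unit_uniform (\<lambda>x. x a) \<Otimes>\<^sub>M distr coordinates unit_uniform (\<lambda>x. x b) =
     distr coordinates (unit_uniform \<Otimes>\<^sub>M unit_uniform) (\<lambda>x. (x a, x b))"
    by (simp add: coord.indep_var_distribution_eq)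
  moreover have "distr coordinates unit_uniform (\<lambda>x. x a) = unit_uniform" for a
    by (rule distr_PiM_component) (simp_all add: unit.prob_space_axioms)
  ultimately show ?thesis by (simp add: square_uniform_def)
qed

lemma AE_coordinates_distinct:
  assumes "a \<noteq> b"
  shows "AE x in coordinates. x a \<noteq> x b"
proof -
  have "AE p in square_uniform. fst p \<noteq> snd p"
  proof -
    have "AE q in unit_uniform. p \<noteq> q" for p
      by (rule AE_I[of _ _ "{p}"]) (auto simp: emeasure_unit_uniform_singleton)
    moreover have "fst \<in> borel_measurable (unit_uniform \<Otimes>\<^sub>M unit_uniform)"
        "snd \<in> borel_measurable (unit_uniform \<Otimes>\<^sub>M unit_uniform)"
      using measurable_fst[of unit_uniform unit_uniform] measurable_snd[of unit_uniform unit_uniform]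
      unfolding measurable_cong_sets[OF refl sets_unit_uniform] .
    ultimately show ?thesis
      unfolding square_uniform_def
      by (intro square.AE_pair_measure borel_measurable_neq) auto
  qed
  then have "AE p in distr coordinates square_uniform (\<lambda>x. (x a, x b)). fst p \<noteq> snd p"
    unfolding distr_two_coordinates[OF assms] .
  then show ?thesis
    by (subst (asm) AE_distr_iff) (auto simp: square_uniform_def)
qed

lemma distr_points: "distr coordinates (PiM UNIV (\<lambda>_. square_uniform)) points = PiM UNIV (\<lambda>_. square_uniform)"
proof -
  have rv: "(\<lambda>x. points x i) \<in> coordinates \<rightarrow>\<^sub>M square_uniform" for i
    unfolding points_def square_uniform_def by measurable
  have "coord.indep_vars (\<lambda>i. PiM {(False, i), (True, i)} (\<lambda>_. unit_uniform))
      (\<lambda>i x. restrict (\<lambda>a. x a) {(False, i), (True, i)}) UNIV"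
    by (rule coord.indep_vars_restrict[OF indep_coordinates]) (auto simp: disjoint_family_on_def)
  then have "coord.indep_vars (\<lambda>_. square_uniform)
      (\<lambda>i x. (\<lambda>y. (y (False, i), y (True, i))) (restrict (\<lambda>a. x a) {(False, i), (True, i)})) UNIV"
    by (rule coord.indep_vars_compose2) (simp add: square_uniform_def)
  then have "coord.indep_vars (\<lambda>_. square_uniform) (\<lambda>i x. points x i) UNIV"
    by (simp add: points_def)
  then have "distr coordinates (PiM UNIV (\<lambda>_. square_uniform)) (\<lambda>x. \<lambda>i\<in>UNIV. points x i) =
     PiM UNIV (\<lambda>i. distr coordinates square_uniform (\<lambda>x. points x i))"
    using rv by (subst (asm) coord.indep_vars_iff_distr_eq_PiM) auto
  then show ?thesis
    by (simp add: restrict_UNIV points_def[abs_def] distr_two_coordinates)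
qed


lemma permute_second_coordinates:
  assumes "\<pi> permutes {1..n}"
  shows "distr coordinates coordinates (\<lambda>x (b, i). x (b, if b then \<pi> i else i)) = coordinates"
proof -
  define f where "f = (\<lambda>(b, i). (b, if b then \<pi> i else i) :: bool \<times> nat)"
  have "inj f"
    using permutes_inj[OF assms] by (auto simp: f_def inj_def split: if_splits)
  then have "distr coordinates coordinates (\<lambda>x. \<lambda>a\<in>UNIV. x (f a)) = coordinates"
    using distr_PiM_reindex[of UNIV "\<lambda>_. unit_uniform" f UNIV] unit.prob_space_axioms by simp
  then show ?thesis by (simp add: restrict_UNIV f_def case_prod_unfold)
qed

lemma measurable_points [measurable]: "points \<in> coordinates \<rightarrow>\<^sub>M PiM UNIV (\<lambda>_. square_uniform)"
proof -
  have "(\<lambda>x. \<lambda>i\<in>UNIV. points x i) \<in> coordinates \<rightarrow>\<^sub>M PiM UNIV (\<lambda>_. square_uniform)"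
    by (rule measurable_restrict) (simp add: points_def square_uniform_def)
  then show ?thesis by (simp add: restrict_UNIV points_def[abs_def])
qed

lemma measurable_permute_second [measurable]:
  "(\<lambda>x (b, i). x (b, if b then \<pi> i else i)) \<in> coordinates \<rightarrow>\<^sub>M coordinates"
proof -
  have "(\<lambda>x. \<lambda>a\<in>UNIV. x (fst a, if fst a then \<pi> (snd a) else snd a)) \<in> coordinates \<rightarrow>\<^sub>M coordinates"
    by (rule measurable_restrict) simp
  then show ?thesis by (simp add: restrict_UNIV case_prod_unfold)
qed

section \<open>The law of the number of chains\<close>

definition chain_count :: "nat \<Rightarrow> nat \<Rightarrow> (nat \<Rightarrow> real \<times> real) \<Rightarrow> real" where
  "chain_count n k x = (\<Sum>S\<in>{S. S \<subseteq> {1..n} \<and> card S = k}. chain_kernel S x)"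

lemma ustat_eq_chain_count:
  assumes "1 \<le> k"
  shows "symmetric_kernel.ustat k chain_kernel n = chain_count n k"
proof -
  interpret symmetric_kernel square_uniform k chain_kernel 1
    by (rule symmetric_kernel_chain[OF assms])
  show ?thesis by (simp add: ustat_def[abs_def] subsets_def chain_count_def[abs_def])
qed

lemma measurable_chain_count:
  assumes "1 \<le> k"
  shows "chain_count n k \<in> borel_measurable (PiM UNIV (\<lambda>_. square_uniform))"
proof -
  interpret symmetric_kernel square_uniform k chain_kernel 1
    by (rule symmetric_kernel_chain[OF assms])
  show ?thesis using measurable_ustat[of n] by (simp add: ustat_eq_chain_count[OF assms])
qed

text \<open>Permuting the ordinates does not change the law of the coordinates, so the probability may be
  averaged over all such permutations inside the expectation. Almost surely the coordinates are
  distinct, and then the average is the probability for a uniform permutation.\<close>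

lemma prob_chain_count_eq:
  assumes k: "1 \<le> k" and A: "A \<in> sets borel"
  shows "measure (distr (PiM UNIV (\<lambda>_. square_uniform)) borel (chain_count n k)) A =
     measure_pmf.expectation (uniform_permutation n) (\<lambda>\<pi>. indicator A (Z n k \<pi>))"
proof -
  let ?P = "{\<pi>. \<pi> permutes {1..n}}"
  let ?\<tau> = "\<lambda>\<pi> (x :: bool \<times> nat \<Rightarrow> real) (b, i). x (b, if b then \<pi> i else i)"
  define p where "p = measure (distr (PiM UNIV (\<lambda>_. square_uniform)) borel (chain_count n k)) A"
  have [measurable]: "chain_count n k \<in> borel_measurable (PiM UNIV (\<lambda>_. square_uniform))"
    by (rule measurable_chain_count[OF k])
  note [measurable] = A
  have meas: "(\<lambda>x. indicator A (chain_count n k (points x)) :: real) \<in> borel_measurable coordinates"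
    by measurable
  have p: "p = (\<integral>x. indicator A (chain_count n k (points (?\<tau> \<pi> x))) \<partial>coordinates)" if "\<pi> permutes {1..n}" for \<pi>
  proof -
    have "p = (\<integral>y. indicator A y \<partial>distr (PiM UNIV (\<lambda>_. square_uniform)) borel (chain_count n k))"
      by (simp add: p_def)
    also have "\<dots> = (\<integral>x. indicator A (chain_count n k x) \<partial>PiM UNIV (\<lambda>_. square_uniform))"
      by (rule integral_distr) measurable
    also have "\<dots> = (\<integral>x. indicator A (chain_count n k x) \<partial>distr coordinates (PiM UNIV (\<lambda>_. square_uniform)) points)"
      by (simp only: distr_points)
    also have "\<dots> = (\<integral>x. indicator A (chain_count n k (points x)) \<partial>coordinates)"
      by (rule integral_distr) measurable
    also have "\<dots> = (\<integral>x. indicator A (chain_count n k (points x)) \<partial>distr coordinates coordinates (?\<tau> \<pi>))"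
      by (simp only: permute_second_coordinates[OF that])
    also have "\<dots> = (\<integral>x. indicator A (chain_count n k (points (?\<tau> \<pi> x))) \<partial>coordinates)"
      by (rule integral_distr[OF measurable_permute_second meas])
    finally show ?thesis .
  qed
  have meas_\<tau>: "(\<lambda>x. indicator A (chain_count n k (points (?\<tau> \<pi> x))) :: real) \<in> borel_measurable coordinates" for \<pi>
    by (rule measurable_compose[OF measurable_permute_second meas])
  have int: "integrable coordinates (\<lambda>x. indicator A (chain_count n k (points (?\<tau> \<pi> x))) :: real)" for \<pi>
    by (rule coord.integrable_const_bound[of _ 1, OF _ meas_\<tau>]) (auto simp: indicator_def)
  have distinct: "AE x in coordinates. \<forall>b. \<forall>i\<in>{1..n}. \<forall>j\<in>{1..n}. i \<noteq> j \<longrightarrow> x (b, i) \<noteq> x (b, j)"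
    using AE_coordinates_distinct[of "(b, i)" "(b, j)" for b i j]
    by (simp add: AE_all_countable AE_ball_countable)
  have "fact n * p = (\<Sum>\<pi>\<in>?P. p)"
    by (simp add: card_permutations)
  also have "\<dots> = (\<Sum>\<pi>\<in>?P. (\<integral>x. indicator A (chain_count n k (points (?\<tau> \<pi> x))) \<partial>coordinates))"
    using p by (intro sum.cong) auto
  also have "\<dots> = (\<integral>x. (\<Sum>\<pi>\<in>?P. indicator A (chain_count n k (points (?\<tau> \<pi> x)))) \<partial>coordinates)"
    by (rule Bochner_Integration.integral_sum[symmetric]) (rule int)
  also have "\<dots> = (\<integral>x. (\<Sum>\<pi>\<in>?P. indicator A (Z n k \<pi>)) \<partial>coordinates)"
  proof (rule integral_cong_AE)
    show "AE x in coordinates. (\<Sum>\<pi>\<in>?P. indicator A (chain_count n k (points (?\<tau> \<pi> x)))) = (\<Sum>\<pi>\<in>?P. indicator A (Z n k \<pi>) :: real)"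
      using distinct
    proof eventually_elim
      case (elim x)
      then have "inj_on (\<lambda>i. x (False, i)) {1..n}" "inj_on (\<lambda>i. x (True, i)) {1..n}"
        by (auto intro!: inj_onI)
      from sum_permutes_chain_sum[OF this, of "indicator A" k] show ?case
        by (simp add: chain_count_def points_def[abs_def])
    qed
  qed (auto intro!: borel_measurable_sum meas_\<tau>)
  also have "\<dots> = (\<Sum>\<pi>\<in>?P. indicator A (Z n k \<pi>))"
    using prob_space.prob_space[OF prob_space_PiM, of "UNIV :: (bool \<times> nat) set" "\<lambda>_. unit_uniform"] unit.prob_space_axioms by simp
  finally have "p = (\<Sum>\<pi>\<in>?P. indicator A (Z n k \<pi>)) / fact n"
    by (simp add: field_simps)
  then show ?thesis
    by (simp only: p_def expectation_uniform_permutation)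
qed

lemma distr_chain_count:
  assumes "1 \<le> k"
  shows "distr (PiM UNIV (\<lambda>_. square_uniform)) borel (chain_count n k) =
     distr (measure_pmf (uniform_permutation n)) borel (Z n k)"
proof (rule measure_eqI)
  have "prob_space (PiM UNIV (\<lambda>_ :: nat. square_uniform))"
    by (rule prob_space_PiM) (rule prob_space_square_uniform)
  then interpret L: prob_space "distr (PiM UNIV (\<lambda>_. square_uniform)) borel (chain_count n k)"
    by (rule prob_space.prob_space_distr) (rule measurable_chain_count[OF assms])
  interpret R: prob_space "distr (measure_pmf (uniform_permutation n)) borel (Z n k)"
    by (rule prob_space.prob_space_distr[OF measure_pmf.prob_space_axioms]) simp
  fix A assume "A \<in> sets (distr (PiM UNIV (\<lambda>_. square_uniform)) borel (chain_count n k))"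
  then have A: "A \<in> sets borel" by simp
  have "measure_pmf.expectation (uniform_permutation n) (\<lambda>\<pi>. indicator A (Z n k \<pi>) :: real) =
     (\<integral>y. indicator A y \<partial>distr (measure_pmf (uniform_permutation n)) borel (Z n k))"
    by (subst integral_distr) (use A in auto)
  also have "\<dots> = measure (distr (measure_pmf (uniform_permutation n)) borel (Z n k)) A"
    using A by simp
  finally show "emeasure (distr (PiM UNIV (\<lambda>_. square_uniform)) borel (chain_count n k)) A =
     emeasure (distr (measure_pmf (uniform_permutation n)) borel (Z n k)) A"
    unfolding L.emeasure_eq_measure R.emeasure_eq_measure prob_chain_count_eq[OF assms A] by simp
qed simp

lemma integral_chain_count:
  fixes f :: "real \<Rightarrow> real"
  assumes "1 \<le> k" and [measurable]: "f \<in> borel_measurable borel"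
  shows "(\<integral>x. f (chain_count n k x) \<partial>PiM UNIV (\<lambda>_. square_uniform)) =
    measure_pmf.expectation (uniform_permutation n) (\<lambda>\<pi>. f (Z n k \<pi>))"
proof -
  have "(\<integral>x. f (chain_count n k x) \<partial>PiM UNIV (\<lambda>_. square_uniform)) =
     integral\<^sup>L (distr (PiM UNIV (\<lambda>_. square_uniform)) borel (chain_count n k)) f"
    by (rule integral_distr[symmetric]) (use measurable_chain_count[OF assms(1)] in auto)
  also have "\<dots> = measure_pmf.expectation (uniform_permutation n) (\<lambda>\<pi>. f (Z n k \<pi>))"
    unfolding distr_chain_count[OF assms(1)] by (rule integral_distr) auto
  finally show ?thesis .
qed

lemma distr_compose_chain_count:
  assumes "1 \<le> k" and [measurable]: "f \<in> borel_measurable borel"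
  shows "distr (PiM UNIV (\<lambda>_. square_uniform)) borel (\<lambda>x. f (chain_count n k x) :: real) =
    distr (measure_pmf (uniform_permutation n)) borel (\<lambda>\<pi>. f (Z n k \<pi>))"
proof -
  have "distr (PiM UNIV (\<lambda>_. square_uniform)) borel (\<lambda>x. f (chain_count n k x)) =
     distr (distr (PiM UNIV (\<lambda>_. square_uniform)) borel (chain_count n k)) borel f"
    by (subst distr_distr) (use measurable_chain_count[OF assms(1)] in \<open>auto simp: comp_def\<close>)
  also have "\<dots> = distr (measure_pmf (uniform_permutation n)) borel (\<lambda>\<pi>. f (Z n k \<pi>))"
    unfolding distr_chain_count[OF assms(1)] by (subst distr_distr) (auto simp: comp_def)
  finally show ?thesis .
qed

section \<open>The limit theorem for increasing subsequences\<close>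

lemma measure_square_uniform_box:
  assumes "A \<in> sets borel" "C \<in> sets borel"
  shows "measure square_uniform (A \<times> C) = measure unit_uniform A * measure unit_uniform C"
  unfolding square_uniform_def using assms
  by (simp add: measure_def unit.emeasure_pair_measure_Times enn2real_mult)

lemma measure_unit_uniform_interval:
  assumes "0 \<le> a" "a \<le> b" "b \<le> 1"
  shows "measure unit_uniform {a..b} = b - a"
proof -
  have "{0..1} \<inter> {a..b} = {a..b}" using assms by auto
  then show ?thesis using assms by (simp add: measure_def emeasure_unit_uniform)
qed

lemma measure_unit_uniform_tails:
  assumes "0 \<le> a" "a \<le> 1"
  shows "measure unit_uniform {..a} = a" "measure unit_uniform {a<..} = 1 - a"
proof -
  have "{0..1} \<inter> {..a} = {0..a}" "{0..1} \<inter> {a<..} = {a<..1}" using assms by auto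
  then show "measure unit_uniform {..a} = a" "measure unit_uniform {a<..} = 1 - a"
    using assms by (simp_all add: measure_def emeasure_unit_uniform)
qed

text \<open>A point \<open>(a, b)\<close> can belong to a chain with a second point only if that point has abscissa at
  most \<open>a\<close> or ordinate larger than \<open>b\<close>, so its projection is at most \<open>a + (1 - b)\<close>. On a small box
  at the corner \<open>(0, 1)\<close> this is less than the mean, which is positive; hence the projection
  is not almost surely constant.\<close>

lemma projection_variance_chain_pos:
  assumes "2 \<le> k"
  shows "0 < symmetric_kernel.projection_variance square_uniform k chain_kernel"
proof -
  interpret symmetric_kernel square_uniform k chain_kernel 1
    by (rule symmetric_kernel_chain) (use assms in simp)
  have k1: "1 \<le> k" using assms by simp
  have "kernel_mean = (\<integral>x. chain_count k k x \<partial>sample UNIV)"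
    using expectation_ustat[of k] by (simp add: ustat_eq_chain_count[OF k1])
  also have "\<dots> = mean_Z k k"
    by (rule integral_chain_count[OF k1, of "\<lambda>x. x"]) simp
  also have "\<dots> = 1 / fact k" by (simp add: mean_Z_eq)
  finally have mean: "0 < kernel_mean" "kernel_mean \<le> 1" by simp_all
  have proj_le: "projection (a, b) \<le> a + (1 - b)" if ab: "0 \<le> a" "a \<le> 1" "0 \<le> b" "b \<le> 1" for a b
  proof -
    let ?J = "{..<k} - {0 :: nat}"
    have J: "1 \<in> ?J" using assms by simp
    have p: "(a, b) \<in> space square_uniform" by (simp add: square_uniform_def space_pair_measure)
    let ?E = "{..a} \<times> UNIV" and ?F = "UNIV \<times> {b<..} :: (real \<times> real) set"
    have EF [measurable]: "?E \<in> sets square_uniform" "?F \<in> sets square_uniform"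
      by (auto simp: sets_square_uniform)
    have mE: "measure square_uniform ?E = a" "measure square_uniform ?F = 1 - b"
      using ab unit.prob_space by (simp_all add: measure_square_uniform_box measure_unit_uniform_tails)
    have comp: "integrable (sample ?J) (\<lambda>x. indicator A (x 1) :: real)"
      "(\<integral>x. indicator A (x 1) \<partial>sample ?J) = measure square_uniform A" if "A \<in> sets square_uniform" for A
    proof -
      have m: "(\<lambda>x. indicator A (x 1) :: real) \<in> borel_measurable (sample ?J)"
        by (rule measurable_compose[OF measurable_component_singleton[OF J]]) (use that in simp)
      then show "integrable (sample ?J) (\<lambda>x. indicator A (x 1) :: real)"
        by (rule integrable_sample_bounded[of _ _ 1]) (simp add: indicator_def)
      have "(\<integral>x. indicator A (x 1) \<partial>sample ?J) = (\<integral>q. (indicator A q :: real) \<partial>distr (sample ?J) square_uniform (\<lambda>x. x 1))"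
        by (subst integral_distr[OF measurable_component_singleton[OF J]]) (use that in simp_all)
      also have "distr (sample ?J) square_uniform (\<lambda>x. x 1) = square_uniform"
        using J by (intro distr_PiM_component) (simp_all add: prob_space_axioms)
      finally show "(\<integral>x. indicator A (x 1) \<partial>sample ?J) = measure square_uniform A"
        using that by simp
    qed
    have "projection (a, b) \<le> (\<integral>x. indicator ?E (x 1) + indicator ?F (x 1) \<partial>sample ?J)"
      unfolding projection_def
    proof (rule integral_mono)
      show "integrable (sample ?J) (\<lambda>x. chain_kernel {..<k} (x(0 := (a, b))))"
        by (rule integrable_sample_bounded[OF measurable_kernel_update' kernel_bounded]) (use k1 p in auto)
      show "integrable (sample ?J) (\<lambda>x. indicator ?E (x 1) + indicator ?F (x 1) :: real)"
        by (intro Bochner_Integration.integrable_add comp EF)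
      show "chain_kernel {..<k} (x(0 := (a, b))) \<le> indicator ?E (x 1) + indicator ?F (x 1)" for x
      proof (cases "x 1 \<in> ?E \<union> ?F")
        case True
        then show ?thesis by (auto simp: chain_kernel_def indicator_def)
      next
        case False
        then have x1: "a < fst (x 1)" "\<not> b < snd (x 1)" by (auto simp: mem_Times_iff)
        have "\<not> (\<forall>i\<in>{..<k}. \<forall>j\<in>{..<k}. fst ((x(0 := (a, b))) i) < fst ((x(0 := (a, b))) j) \<longrightarrow>
            snd ((x(0 := (a, b))) i) < snd ((x(0 := (a, b))) j))"
        proof (intro notI)
          assume H: "\<forall>i\<in>{..<k}. \<forall>j\<in>{..<k}. fst ((x(0 := (a, b))) i) < fst ((x(0 := (a, b))) j) \<longrightarrow>
            snd ((x(0 := (a, b))) i) < snd ((x(0 := (a, b))) j)"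
          have "0 \<in> {..<k}" "1 \<in> {..<k}" using assms by auto
          from H[rule_format, OF this] show False
            using x1 by simp
        qed
        then have "chain_kernel {..<k} (x(0 := (a, b))) = 0"
          unfolding chain_kernel_def by (simp only: of_bool_eq)
        then show ?thesis by simp
      qed
    qed
    also have "\<dots> = a + (1 - b)"
      using comp[OF EF(1)] comp[OF EF(2)] mE by simp
    finally show ?thesis .
  qed
  \<comment> \<open>The bound on the box is \<open>2 * e\<close>, half the mean.\<close>
  define e where "e = kernel_mean / 4"
  have e: "0 < e" "e < 1" "2 * e < kernel_mean" using mean by (simp_all add: e_def)
  have sq_bound: "(projection p - kernel_mean)\<^sup>2 \<le> 4" for p
    using power_mono[OF centered_projection_bounded abs_ge_zero, of p 2] by simp
  have "projection_variance \<noteq> 0"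
  proof
    assume "projection_variance = 0"
    then have "AE p in square_uniform. (projection p - kernel_mean)\<^sup>2 = 0"
      unfolding projection_variance_def
      by (subst (asm) integral_nonneg_eq_0_iff_AE)
         (use sq_bound in \<open>auto intro!: integrable_const_bound[of _ 4] AE_I2\<close>)
    moreover have "(projection p - kernel_mean)\<^sup>2 \<noteq> 0" if "p \<in> {0..e} \<times> {1 - e..1}" for p
      using that proj_le[of "fst p" "snd p"] e by (auto simp: mem_Times_iff)
    ultimately have "AE p in square_uniform. p \<notin> {0..e} \<times> {1 - e..1}"
      by (auto elim!: eventually_mono)
    then have "measure square_uniform ({0..e} \<times> {1 - e..1}) = 0"
      by (subst (asm) AE_iff_measurable[OF _ refl]) (auto simp: sets_square_uniform measure_def square_uniform_def space_pair_measure)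
    then show False
      using e by (simp add: measure_square_uniform_box measure_unit_uniform_interval)
  qed
  moreover have "0 \<le> projection_variance" by (simp add: projection_variance_def)
  ultimately show ?thesis by simp
qed

theorem Z_clt:
  assumes "2 \<le> k"
  shows "weak_conv_m
          (\<lambda>n. distr (measure_pmf (uniform_permutation n)) borel
                 (\<lambda>\<pi>. (Z n k \<pi> - mean_Z n k) / sqrt (var_Z n k)))
          std_normal_distribution"
proof -
  have k: "1 \<le> k" using assms by simp
  interpret symmetric_kernel square_uniform k chain_kernel 1
    by (rule symmetric_kernel_chain[OF k])
  have mean: "(\<integral>x. chain_count n k x \<partial>sample UNIV) = mean_Z n k" for n
    by (rule integral_chain_count[OF k, of "\<lambda>x. x"]) simp
  have var: "(\<integral>x. (chain_count n k x - mean_Z n k)\<^sup>2 \<partial>sample UNIV) = var_Z n k" for n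
    by (rule integral_chain_count[OF k, of "\<lambda>x. (x - mean_Z n k)\<^sup>2"]) simp
  have "distr (sample UNIV) borel (\<lambda>x. (chain_count n k x - mean_Z n k) / sqrt (var_Z n k)) =
     distr (measure_pmf (uniform_permutation n)) borel (\<lambda>\<pi>. (Z n k \<pi> - mean_Z n k) / sqrt (var_Z n k))" for n
    by (rule distr_compose_chain_count[OF k]) simp
  then show ?thesis
    using ustat_clt[OF projection_variance_chain_pos[OF assms]]
    by (simp only: ustat_eq_chain_count[OF k] mean var)
qed

theorem variance_Z_eq:
  "var_Z n k = measure_pmf.expectation (uniform_permutation n) (\<lambda>\<pi>. (Z n k \<pi>)\<^sup>2) - (mean_Z n k)\<^sup>2"
proof -
  have "finite (set_pmf (uniform_permutation n))"
    unfolding uniform_permutation_def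
    by (subst set_pmf_of_set) (auto simp: finite_permutations intro: exI[of _ id] permutes_id)
  then show ?thesis
    by (intro measure_pmf.variance_eq integrable_measure_pmf_finite)
qed

theorem theorem4p1:
  fixes k :: nat
  assumes "k \<ge> 1"
  shows
    "(k \<ge> 2 \<longrightarrow>
        weak_conv_m
          (\<lambda>n. distr (measure_pmf (uniform_permutation n)) borel
                 (\<lambda>\<pi>. (Z n k \<pi> - mean_Z n k) / sqrt (var_Z n k)))
          std_normal_distribution)
     \<and> (\<forall>n. mean_Z n k = real (n choose k) * (1 / fact k))
     \<and> (\<forall>n. var_Z n k =
            measure_pmf.expectation (uniform_permutation n) (\<lambda>\<pi>. (Z n k \<pi>)\<^sup>2) - (mean_Z n k)\<^sup>2)
     \<and> (\<forall>n. measure_pmf.expectation (uniform_permutation n) (\<lambda>\<pi>. (Z n k \<pi>)\<^sup>2)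
            = second_moment_formula n k)"
  using Z_clt mean_Z_eq variance_Z_eq second_moment_Z by (intro conjI allI impI)

end
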